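(* Let $\Theta\subseteq\mathbb{R}^k$, $\Lambda\subseteq\mathbb{R}^\ell$, and for each $\lambda\in\Lambda$ let $\Pi(\cdot|\lambda)$ be a prior on $\Theta$ with density $\pi(\cdot|\lambda)$ with respect to a common measure $\nu$. Let $\hat\lambda_n$ be the maximum marginal likelihood estimator, with $m(X_{1:n}|\lambda)=\int_\Theta p_\theta^{(n)}(X_{1:n})\pi(\theta|\lambda)\,\mathrm{d}\nu(\theta)$ and $\hat m(X_{1:n})=m(X_{1:n}|\hat\lambda_n)$. Let $g(\theta)=\sup_{\lambda\in\Lambda}\pi(\theta|\lambda)$ and suppose that the true value $\theta_0\in\Theta$ satisfies $g(\theta_0)<\infty$. Let $$\Lambda_0=\{\lambda_0\in\Lambda:\pi(\theta_0|\lambda_0)=g(\theta_0)\}$$ and let $\tilde\Lambda_0\subseteq\Lambda_0$ be the set of all $\lambda_0\in\Lambda_0$ for which the map $\theta\mapsto\pi(\theta|\lambda_0)$ is continuous at $\theta_0$ and, for any $\epsilon,\eta>0$, $\Pi(U_\epsilon\cap B_{\mathrm{KL}}(\theta_0;\eta)|\lambda_0)>0$. Assume: (A1) there exist constants $c_1,c_2>0$ such that, for any $\epsilon>0$, $P_0^*\bigl(\sup_{\theta\in U_\epsilon^c}R(p_\theta^{(n)})\ge e^{-c_1n\epsilon^2}\bigr)\le c_2(n\epsilon^2)^{-(1+t)}$ for all $n$, for some $t>0$, where $P_0^*$ denotes the outer measure of $P_0^\infty$; (i) the map $g:\theta\mapsto\sup_{\lambda\in\Lambda}\pi(\theta|\lambda)$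 is positive and continuous at $\theta_0$; (ii) $\tilde\Lambda_0\ne\emptyset$. Then, for each $\lambda_0\in\tilde\Lambda_0$, $$\frac{\hat m(X_{1:n})}{m(X_{1:n}|\lambda_0)}\to1\quad\text{a.s. }[P_0^\infty].$$ If, in addition, (iii) $\tilde\Lambda_0=\Lambda_0$ is included in the interior of $\Lambda$ and, for any $\delta>0$, there exist $\epsilon,\eta>0$ such that $$\sup_{\theta\in U_\epsilon}\ \sup_{\lambda\in\Lambda:\,d(\lambda,\Lambda_0)>\delta}\frac{\pi(\theta|\lambda)}{g(\theta)}\le1-\eta,\qquad d(\lambda,\Lambda_0):=\inf_{\lambda_0\in\Lambda_0}d(\lambda,\lambda_0),$$ then, for each $\lambda_0\in\Lambda_0$, $$d(\hat\lambda_n,\Lambda_0)\to0\quad\text{and}\quad\|\pi(\cdot|\hat\lambda_n,X_{1:n})-\pi(\cdot|\lambda_0,X_{1:n})\|_1\to0\quad\text{a.s. }[P_0^\infty].$$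
   Context: $\mathcal{X}$ (observations) is a complete separable metric space, and so is $\Theta$; $(X_i)_{i\ge1}$ is a sequence of $\mathcal{X}$-valued random elements whose law is modeled by a family $\{P_\theta^\infty:\theta\in\Theta\}$ (not necessarily i.i.d.). $X_{1:n}=(X_1,\ldots,X_n)$ has law $P_\theta^{(n)}$ with density $p_\theta^{(n)}$ with respect to a common $\sigma$-finite measure (possibly depending on $n$). $\theta_0$ is the true value and $P_0^\infty=P_{\theta_0}^\infty$. The likelihood ratio is $R(p_\theta^{(n)})=p_\theta^{(n)}(X_{1:n})/p_{\theta_0}^{(n)}(X_{1:n})$. The symbol $d$ denotes a semi-metric on $\Theta$ and also a metric on $\Lambda$; $U_\epsilon=\{\theta\in\Theta:d(\theta,\theta_0)<\epsilon\}$; continuity at $\theta_0$ is with respect to $d$. $\mathrm{KL}_\infty(\theta_0;\theta)=-\lim_{n\to\infty}n^{-1}\log R(p_\theta^{(n)})$ (the $P_0^\infty$-a.s. limit, assumed to be a nonrandom number; in the i.i.d. case it is the Kullback–Leibler divergence of $p_\theta$ from $p_{\theta_0}$), and $B_{\mathrm{KL}}(\theta_0;\eta)=\{\theta\in\Theta:\mathrm{KL}_\infty(\theta_0;\theta)<\eta\}$. The maximum marginal likelihood estimator is $\hat\lambda_n\in\operatorname{argmax}_{\lambda\in\Lambda}m(X_{1:n}|\lambda)$. It may take values in the closure of $\Lambda$; for $\lambda$ in the boundary, $\Pi(\cdot|\lambda)$ is the weak limit of the priors at values tending to $\lambda$, when it exists. In all cases $\hat m(X_{1:n})=\sup_{\lambda\in\Lambda}m(X_{1:n}|\lambda)$,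 assumed finite for all large $n$, $P_\theta^\infty$-a.s., for all $\theta$. $\pi(\theta|\lambda,X_{1:n})=p_\theta^{(n)}(X_{1:n})\pi(\theta|\lambda)/m(X_{1:n}|\lambda)$ is the posterior density with respect to $\nu$, and $\pi(\cdot|\hat\lambda_n,X_{1:n})$, the empirical Bayes posterior density, is obtained by plugging in $\lambda=\hat\lambda_n$ (part of the last conclusion is that this density exists for all large $n$, a.s.); $\|\cdot\|_1$ is the $L_1(\nu)$-norm. The empirical Bayes posterior is assumed well defined, i.e. a probability measure for all large $n$, $P_\theta^\infty$-a.s., for all $\theta$. The usual measurability (of $(x,\theta)\mapsto p_\theta^{(n)}(x)$, of $g$, and of the sets to which priors are applied) is assumed.
   Formalization: For the final L1 (and density-existence) conclusion it is also assumed that, for some r>0, every possible value λ of the estimator with d(λ,Λ0)<r lies in Λ; otherwise the estimator may stay at boundary points whose weak-limit prior has no density. *)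

theory Defs
  imports "HOL-Probability.Probability"
begin

text \<open>
  A sample path is a function \<open>x :: nat \<Rightarrow> 'x\<close>; the observations $X_1, X_2, \ldots$ are its coordinates
  \<open>x 0, x 1, \<dots>\<close>, so that $X_{1:n}$ is the restriction of \<open>x\<close> to \<open>{..<n}\<close>. Throughout,
  \<open>p n \<theta> :: (nat \<Rightarrow> 'x) \<Rightarrow> real\<close> is the density of $X_{1:n}$ under \<open>\<theta>\<close>, and
  \<open>\<pi> l :: 't \<Rightarrow> real\<close> is the prior density with hyperparameter \<open>l\<close>.
\<close>

definition first_obs :: "nat \<Rightarrow> (nat \<Rightarrow> 'x) \<Rightarrow> nat \<Rightarrow> 'x" where
  "first_obs n x = restrict x {..<n}"

definition likelihood_ratio ::
  "(nat \<Rightarrow> 't \<Rightarrow> (nat \<Rightarrow> 'x) \<Rightarrow> real) \<Rightarrow> 't \<Rightarrow> nat \<Rightarrow> 't \<Rightarrow> (nat \<Rightarrow> 'x) \<Rightarrow> real" where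
  "likelihood_ratio p \<theta>0 n \<theta> x = p n \<theta> (first_obs n x) / p n \<theta>0 (first_obs n x)"

text \<open>The library has \<open>ln 0 = 0\<close> on the reals; a vanishing likelihood ratio must count as \<open>-\<infinity>\<close>.\<close>

definition ln_ext :: "real \<Rightarrow> ereal" where
  "ln_ext r = (if r \<le> 0 then -\<infinity> else ereal (ln r))"

text \<open>
  The almost sure limit is taken in the extended reals, so that \<open>KL = \<infinity>\<close> (as may happen for i.i.d. data)
  is allowed. The limit is unique whenever it exists, \<open>P0\<close> being a probability measure.
\<close>

definition is_KL_inf ::
  "(nat \<Rightarrow> 'x) measure \<Rightarrow> (nat \<Rightarrow> 't \<Rightarrow> (nat \<Rightarrow> 'x) \<Rightarrow> real) \<Rightarrow> 't \<Rightarrow> 't \<Rightarrow> ereal \<Rightarrow> bool" where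
  "is_KL_inf P0 p \<theta>0 \<theta> c \<longleftrightarrow>
     (AE x in P0. (\<lambda>n. - (ln_ext (likelihood_ratio p \<theta>0 n \<theta> x) / ereal (real n))) \<longlonglongrightarrow> c)"

definition KL_inf ::
  "(nat \<Rightarrow> 'x) measure \<Rightarrow> (nat \<Rightarrow> 't \<Rightarrow> (nat \<Rightarrow> 'x) \<Rightarrow> real) \<Rightarrow> 't \<Rightarrow> 't \<Rightarrow> ereal" where
  "KL_inf P0 p \<theta>0 \<theta> = (THE c. is_KL_inf P0 p \<theta>0 \<theta> c)"

definition KL_ball ::
  "'t set \<Rightarrow> (nat \<Rightarrow> 'x) measure \<Rightarrow> (nat \<Rightarrow> 't \<Rightarrow> (nat \<Rightarrow> 'x) \<Rightarrow> real) \<Rightarrow> 't \<Rightarrow> real \<Rightarrow> 't set" where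
  "KL_ball \<Theta> P0 p \<theta>0 \<eta> = {\<theta>\<in>\<Theta>. KL_inf P0 p \<theta>0 \<theta> < ereal \<eta>}"

text \<open>As usual in statistics, a semi-metric need not separate points but obeys the triangle inequality.\<close>

definition semi_metric_on :: "'t set \<Rightarrow> ('t \<Rightarrow> 't \<Rightarrow> real) \<Rightarrow> bool" where
  "semi_metric_on \<Theta> d \<longleftrightarrow>
     (\<forall>a\<in>\<Theta>. d a a = 0) \<and> (\<forall>a\<in>\<Theta>. \<forall>b\<in>\<Theta>. 0 \<le> d a b \<and> d a b = d b a) \<and>
     (\<forall>a\<in>\<Theta>. \<forall>b\<in>\<Theta>. \<forall>c\<in>\<Theta>. d a c \<le> d a b + d b c)"

definition d_ball :: "'t set \<Rightarrow> ('t \<Rightarrow> 't \<Rightarrow> real) \<Rightarrow> 't \<Rightarrow> real \<Rightarrow> 't set" where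
  "d_ball \<Theta> d \<theta>0 \<epsilon> = {\<theta>\<in>\<Theta>. d \<theta> \<theta>0 < \<epsilon>}"

definition d_continuous_at ::
  "'t set \<Rightarrow> ('t \<Rightarrow> 't \<Rightarrow> real) \<Rightarrow> 't \<Rightarrow> ('t \<Rightarrow> 'b::topological_space) \<Rightarrow> bool" where
  "d_continuous_at \<Theta> d \<theta>0 f \<longleftrightarrow>
     (f \<longlongrightarrow> f \<theta>0) (INF \<epsilon>\<in>{0<..}. principal (d_ball \<Theta> d \<theta>0 \<epsilon>))"

definition d_set :: "('l \<Rightarrow> 'l \<Rightarrow> real) \<Rightarrow> 'l \<Rightarrow> 'l set \<Rightarrow> real" where
  "d_set d l A = (INF a\<in>A. d l a)"

definition prior :: "'t measure \<Rightarrow> ('l \<Rightarrow> 't \<Rightarrow> real) \<Rightarrow> 'l \<Rightarrow> 't measure" where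
  "prior \<nu> \<pi> l = density \<nu> (\<lambda>\<theta>. ennreal (\<pi> l \<theta>))"

definition sup_prior :: "'l set \<Rightarrow> ('l \<Rightarrow> 't \<Rightarrow> real) \<Rightarrow> 't \<Rightarrow> ennreal" where
  "sup_prior \<Lambda> \<pi> \<theta> = (SUP l\<in>\<Lambda>. ennreal (\<pi> l \<theta>))"

definition Lambda0 :: "'l set \<Rightarrow> ('l \<Rightarrow> 't \<Rightarrow> real) \<Rightarrow> 't \<Rightarrow> 'l set" where
  "Lambda0 \<Lambda> \<pi> \<theta>0 = {l\<in>\<Lambda>. ennreal (\<pi> l \<theta>0) = sup_prior \<Lambda> \<pi> \<theta>0}"

definition Lambda0_tilde ::
  "'t set \<Rightarrow> 'l set \<Rightarrow> 't measure \<Rightarrow> ('l \<Rightarrow> 't \<Rightarrow> real) \<Rightarrow> ('t \<Rightarrow> 't \<Rightarrow> real) \<Rightarrow>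
   (nat \<Rightarrow> 'x) measure \<Rightarrow> (nat \<Rightarrow> 't \<Rightarrow> (nat \<Rightarrow> 'x) \<Rightarrow> real) \<Rightarrow> 't \<Rightarrow> 'l set" where
  "Lambda0_tilde \<Theta> \<Lambda> \<nu> \<pi> d P0 p \<theta>0 =
     {l\<in>Lambda0 \<Lambda> \<pi> \<theta>0. d_continuous_at \<Theta> d \<theta>0 (\<pi> l) \<and>
        (\<forall>\<epsilon>>0. \<forall>\<eta>>0. emeasure (prior \<nu> \<pi> l) (d_ball \<Theta> d \<theta>0 \<epsilon> \<inter> KL_ball \<Theta> P0 p \<theta>0 \<eta>) > 0)}"

definition marginal ::
  "'t measure \<Rightarrow> (nat \<Rightarrow> 't \<Rightarrow> (nat \<Rightarrow> 'x) \<Rightarrow> real) \<Rightarrow> ('l \<Rightarrow> 't \<Rightarrow> real) \<Rightarrow>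
   nat \<Rightarrow> (nat \<Rightarrow> 'x) \<Rightarrow> 'l \<Rightarrow> ennreal" where
  "marginal \<nu> p \<pi> n x l = (\<integral>\<^sup>+\<theta>. ennreal (p n \<theta> (first_obs n x) * \<pi> l \<theta>) \<partial>\<nu>)"

definition max_marginal ::
  "'t measure \<Rightarrow> (nat \<Rightarrow> 't \<Rightarrow> (nat \<Rightarrow> 'x) \<Rightarrow> real) \<Rightarrow> ('l \<Rightarrow> 't \<Rightarrow> real) \<Rightarrow> 'l set \<Rightarrow>
   nat \<Rightarrow> (nat \<Rightarrow> 'x) \<Rightarrow> ennreal" where
  "max_marginal \<nu> p \<pi> \<Lambda> n x = (SUP l\<in>\<Lambda>. marginal \<nu> p \<pi> n x l)"

definition posterior_density ::
  "'t measure \<Rightarrow> (nat \<Rightarrow> 't \<Rightarrow> (nat \<Rightarrow> 'x) \<Rightarrow> real) \<Rightarrow> ('l \<Rightarrow> 't \<Rightarrow> real) \<Rightarrow>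
   nat \<Rightarrow> (nat \<Rightarrow> 'x) \<Rightarrow> 'l \<Rightarrow> 't \<Rightarrow> real" where
  "posterior_density \<nu> p \<pi> n x l \<theta> =
     p n \<theta> (first_obs n x) * \<pi> l \<theta> / enn2real (marginal \<nu> p \<pi> n x l)"

text \<open>
  \<open>is_maximizer \<Lambda> m l\<close>: \<open>l\<close> maximizes \<open>m\<close> over \<open>\<Lambda>\<close>, or \<open>l\<close> is a point of the closure outside \<open>\<Lambda>\<close> to which
  a maximizing sequence converges (the supremum is then attained at \<open>l\<close> only in the limit).
\<close>

definition is_maximizer :: "'l::topological_space set \<Rightarrow> ('l \<Rightarrow> ennreal) \<Rightarrow> 'l \<Rightarrow> bool" where
  "is_maximizer \<Lambda> m l \<longleftrightarrow>
     (if l \<in> \<Lambda> then m l = (SUP l'\<in>\<Lambda>. m l')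
      else \<exists>s. (\<forall>j. s j \<in> \<Lambda>) \<and> s \<longlonglongrightarrow> l \<and> (\<lambda>j. m (s j)) \<longlonglongrightarrow> (SUP l'\<in>\<Lambda>. m l'))"

text \<open>\<open>Q\<close> is the prior at \<open>l\<close>; outside \<open>\<Lambda>\<close> it is the weak limit of the priors and may have no density.\<close>

definition is_prior_at ::
  "'t::topological_space set \<Rightarrow> 'l::topological_space set \<Rightarrow> 't measure \<Rightarrow> ('l \<Rightarrow> 't \<Rightarrow> real) \<Rightarrow>
   'l \<Rightarrow> 't measure \<Rightarrow> bool" where
  "is_prior_at \<Theta> \<Lambda> \<nu> \<pi> l Q \<longleftrightarrow>
     (if l \<in> \<Lambda> then Q = prior \<nu> \<pi> l
      else prob_space Q \<and> sets Q = sets \<nu> \<and>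
        (\<forall>f :: 't \<Rightarrow> real. continuous_on \<Theta> f \<longrightarrow> bounded (f ` \<Theta>) \<longrightarrow>
           ((\<lambda>l'. \<integral>\<theta>. f \<theta> \<partial>prior \<nu> \<pi> l') \<longlongrightarrow> (\<integral>\<theta>. f \<theta> \<partial>Q)) (at l within \<Lambda>)))"

definition posterior ::
  "(nat \<Rightarrow> 't \<Rightarrow> (nat \<Rightarrow> 'x) \<Rightarrow> real) \<Rightarrow> nat \<Rightarrow> (nat \<Rightarrow> 'x) \<Rightarrow> 't measure \<Rightarrow> 't measure" where
  "posterior p n x Q =
     density Q (\<lambda>\<theta>. ennreal (p n \<theta> (first_obs n x)) / (\<integral>\<^sup>+\<theta>'. ennreal (p n \<theta>' (first_obs n x)) \<partial>Q))"

definition posterior_well_defined ::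
  "'t::topological_space set \<Rightarrow> 'l::topological_space set \<Rightarrow> 't measure \<Rightarrow> ('l \<Rightarrow> 't \<Rightarrow> real) \<Rightarrow>
   (nat \<Rightarrow> 't \<Rightarrow> (nat \<Rightarrow> 'x) \<Rightarrow> real) \<Rightarrow> nat \<Rightarrow> (nat \<Rightarrow> 'x) \<Rightarrow> 'l \<Rightarrow> bool" where
  "posterior_well_defined \<Theta> \<Lambda> \<nu> \<pi> p n x l \<longleftrightarrow>
     (\<exists>Q. is_prior_at \<Theta> \<Lambda> \<nu> \<pi> l Q \<and> prob_space (posterior p n x Q))"

definition condition_A1 ::
  "'t set \<Rightarrow> ('t \<Rightarrow> 't \<Rightarrow> real) \<Rightarrow> (nat \<Rightarrow> 'x) measure \<Rightarrow>
   (nat \<Rightarrow> 't \<Rightarrow> (nat \<Rightarrow> 'x) \<Rightarrow> real) \<Rightarrow> 't \<Rightarrow> bool" where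
  "condition_A1 \<Theta> d P0 p \<theta>0 \<longleftrightarrow>
     (\<exists>c1>0. \<exists>c2>0. \<forall>\<epsilon>>0. \<exists>t>0. \<forall>n\<ge>1.
        outer_measure_of P0
          {x\<in>space P0. (SUP \<theta>\<in>\<Theta> - d_ball \<Theta> d \<theta>0 \<epsilon>. ennreal (likelihood_ratio p \<theta>0 n \<theta> x))
             \<ge> ennreal (exp (- c1 * real n * \<epsilon>\<^sup>2))}
        \<le> ennreal (c2 * (real n * \<epsilon>\<^sup>2) powr (- (1 + t))))"

definition condition_iii ::
  "'t set \<Rightarrow> 'l::topological_space set \<Rightarrow> 't measure \<Rightarrow> ('l \<Rightarrow> 't \<Rightarrow> real) \<Rightarrow> ('t \<Rightarrow> 't \<Rightarrow> real) \<Rightarrow>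
   ('l \<Rightarrow> 'l \<Rightarrow> real) \<Rightarrow> (nat \<Rightarrow> 'x) measure \<Rightarrow>
   (nat \<Rightarrow> 't \<Rightarrow> (nat \<Rightarrow> 'x) \<Rightarrow> real) \<Rightarrow> 't \<Rightarrow> bool" where
  "condition_iii \<Theta> \<Lambda> \<nu> \<pi> d dL P0 p \<theta>0 \<longleftrightarrow>
     Lambda0_tilde \<Theta> \<Lambda> \<nu> \<pi> d P0 p \<theta>0 = Lambda0 \<Lambda> \<pi> \<theta>0 \<and>
     Lambda0 \<Lambda> \<pi> \<theta>0 \<subseteq> interior \<Lambda> \<and>
     (\<forall>\<delta>>0. \<exists>\<epsilon>>0. \<exists>\<eta>>0.
        (SUP \<theta>\<in>d_ball \<Theta> d \<theta>0 \<epsilon>. SUP l\<in>{l\<in>\<Lambda>. d_set dL l (Lambda0 \<Lambda> \<pi> \<theta>0) > \<delta>}.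
           ennreal (\<pi> l \<theta>) / sup_prior \<Lambda> \<pi> \<theta>) \<le> ennreal (1 - \<eta>))"

end

theory Submission
  imports Defs
begin

text \<open>
  Almost surely, for every \<open>\<epsilon>\<close> the likelihood outside the \<open>\<epsilon>\<close>-ball around \<open>\<theta>0\<close> is eventually at most any
  prescribed multiple of \<open>m(X|l0)\<close>: by (A1) and Borel--Cantelli it is exponentially small relative to the
  likelihood of \<open>\<theta>0\<close>, whereas the positive prior mass of the Kullback--Leibler balls (Fubini and Fatou)
  lets \<open>m(X|l0)\<close> decay only at an arbitrarily slow exponential rate. On a small ball, continuity and
  \<open>g(\<theta>0) = \<pi>(\<theta>0|l0)\<close> give \<open>\<pi>(\<cdot>|l) \<le> g \<le> (1 + \<rho>) \<pi>(\<cdot>|l0)\<close> for all \<open>l\<close> at once. Together these bound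
  \<open>m(X|l)\<close> by \<open>(1 + \<rho> + \<kappa>) m(X|l0)\<close> uniformly in \<open>l\<close>; under (iii) the factor drops below 1 away from
  \<open>\<Lambda>0\<close>, which excludes such \<open>l\<close> as maximizers. The same pointwise bound yields the \<open>L\<^sub>1\<close> merging.
\<close>

section \<open>Almost sure consequences of (A1) and of the Kullback-Leibler limits\<close>

text \<open>A supremum over uncountably many \<open>\<theta>\<close>, as in (A1), need not be
  measurable in the path. Each set is therefore enlarged to a measurable one of the same outer
  measure, and Borel-Cantelli is applied to the enlargements.\<close>

lemma AE_eventually_not_outer_measure_of:
  fixes b :: "nat \<Rightarrow> real"
  assumes sub: "\<And>n. A n \<subseteq> space M"
    and le: "\<And>n. outer_measure_of M (A n) \<le> ennreal (b n)"
    and b: "\<And>n. 0 \<le> b n" "summable b"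
  shows "AE x in M. \<forall>\<^sub>F n in sequentially. x \<notin> A n"
proof -
  have "\<exists>E\<in>sets M. A n \<subseteq> E \<and> outer_measure_of M (A n) = emeasure M E" for n
    using outer_measure_of_attain[OF sub] .
  then obtain E where E: "\<And>n. E n \<in> sets M" "\<And>n. A n \<subseteq> E n"
    "\<And>n. outer_measure_of M (A n) = emeasure M (E n)"
    by metis
  have Eb: "emeasure M (E n) \<le> ennreal (b n)" for n
    using le E(3) by metis
  have fin: "emeasure M (E n) < \<infinity>" for n
    using Eb[of n] by (simp add: le_less_trans)
  have "measure M (E n) \<le> b n" for n
    using Eb[of n] b(1)[of n] by (simp add: measure_def enn2real_leI)
  then have "summable (\<lambda>n. measure M (E n))"
    by (intro summable_comparison_test'[OF b(2)]) simp
  from borel_cantelli_AE1[OF E(1) fin this]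
  show ?thesis
  proof eventually_elim
    case (elim x)
    then show ?case
      by eventually_elim (use E(2) in blast)
  qed
qed

text \<open>The balls around \<open>\<theta>0\<close> are directed, since the smaller of two radii
  serves both. They form a filter base, so whatever holds eventually holds on a single ball.\<close>

lemma d_continuous_at_eventually:
  assumes "d_continuous_at \<Theta> d \<theta>0 f" "open S" "f \<theta>0 \<in> S"
  obtains \<epsilon> where "\<epsilon> > 0" "\<And>\<theta>. \<theta> \<in> d_ball \<Theta> d \<theta>0 \<epsilon> \<Longrightarrow> f \<theta> \<in> S"
proof -
  have "\<forall>\<^sub>F \<theta> in (INF \<epsilon>\<in>{0<..}. principal (d_ball \<Theta> d \<theta>0 \<epsilon>)). f \<theta> \<in> S"
    using assms unfolding d_continuous_at_def by (blast dest: topological_tendstoD)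
  moreover have "\<exists>e\<in>{0<..}. principal (d_ball \<Theta> d \<theta>0 e)
      \<le> inf (principal (d_ball \<Theta> d \<theta>0 a)) (principal (d_ball \<Theta> d \<theta>0 b))"
    if "a \<in> {0<..}" "b \<in> {0<..}" for a b
    using that by (intro bexI[of _ "min a b"]) (auto simp: d_ball_def)
  ultimately obtain e where "e \<in> {0<..}" "\<forall>\<^sub>F \<theta> in principal (d_ball \<Theta> d \<theta>0 e). f \<theta> \<in> S"
    by (subst (asm) eventually_INF_base) auto
  then show ?thesis
    by (intro that[of e]) (auto simp: eventually_principal)
qed

lemma d_ball_mono: "\<epsilon> \<le> \<epsilon>' \<Longrightarrow> d_ball \<Theta> d \<theta>0 \<epsilon> \<subseteq> d_ball \<Theta> d \<theta>0 \<epsilon>'"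
  by (auto simp: d_ball_def)

lemma is_KL_inf_unique:
  assumes "prob_space P0" "is_KL_inf P0 p \<theta>0 \<theta> c" "is_KL_inf P0 p \<theta>0 \<theta> c'"
  shows "c = c'"
proof -
  interpret prob_space P0 by fact
  have "AE x in P0. c = c'"
    using assms(2,3) unfolding is_KL_inf_def
    by eventually_elim (rule LIMSEQ_unique)
  then show ?thesis by simp
qed

text \<open>\<open>KL_inf\<close> is a definite description; existence and uniqueness together let
  it inherit the limit property.\<close>

lemma is_KL_inf_KL_inf:
  assumes "prob_space P0" "is_KL_inf P0 p \<theta>0 \<theta> c"
  shows "is_KL_inf P0 p \<theta>0 \<theta> (KL_inf P0 p \<theta>0 \<theta>)"
  unfolding KL_inf_def by (rule theI[where P = "is_KL_inf P0 p \<theta>0 \<theta>", OF assms(2)]) (rule is_KL_inf_unique[OF assms(1) _ assms(2)])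

lemma ln_ext_gt_imp_exp_less:
  assumes "n \<ge> 1" "- (ln_ext r / ereal (real n)) < ereal \<eta>"
  shows "exp (- (\<eta> * real n)) < r"
proof (cases "r \<le> 0")
  case True
  \<comment> \<open>Here the quotient is \<open>-\<infinity>\<close>, so the hypothesis would read
    \<open>\<infinity> < ereal \<eta>\<close>.\<close>
  with assms show ?thesis by (simp add: ln_ext_def)
next
  case False
  with assms have "- (ln r / real n) < \<eta>" by (simp add: ln_ext_def)
  then have "- (\<eta> * real n) < ln r" using assms(1) by (simp add: field_simps)
  then have "exp (- (\<eta> * real n)) < exp (ln r)" by simp
  with False show ?thesis by simp
qed

lemma KL_inf_less_AE_likelihood_ratio:
  assumes P0: "prob_space P0" and ex: "\<exists>c. is_KL_inf P0 p \<theta>0 \<theta> c" and less: "KL_inf P0 p \<theta>0 \<theta> < ereal \<eta>"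
  shows "AE x in P0. \<forall>\<^sub>F n in sequentially. exp (- (\<eta> * real n)) < likelihood_ratio p \<theta>0 n \<theta> x"
proof -
  have "is_KL_inf P0 p \<theta>0 \<theta> (KL_inf P0 p \<theta>0 \<theta>)"
    using ex by (elim exE) (rule is_KL_inf_KL_inf[OF P0])
  then show ?thesis
    unfolding is_KL_inf_def
  proof eventually_elim
    case (elim x)
    have "\<forall>\<^sub>F n in sequentially. - (ln_ext (likelihood_ratio p \<theta>0 n \<theta> x) / ereal (real n)) < ereal \<eta>"
      using order_tendstoD(2)[OF elim less] .
    with eventually_ge_at_top[of 1] show ?case
      by eventually_elim (rule ln_ext_gt_imp_exp_less)
  qed
qed

text \<open>The exponent \<open>- (1 + t)\<close> is below -1, so for fixed
  \<open>\<epsilon>\<close> the bounds of (A1) are summable in \<open>n\<close>, whatever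
  \<open>t\<close> belongs to that \<open>\<epsilon>\<close>. Only the rate constant survives, and
  it is common to all radii.\<close>

lemma condition_A1_AE:
  assumes "condition_A1 \<Theta> d P0 p \<theta>0"
  obtains c where "c > 0" "\<And>\<epsilon>. \<epsilon> > 0 \<Longrightarrow> AE x in P0. \<forall>\<^sub>F n in sequentially.
     \<forall>\<theta>\<in>\<Theta> - d_ball \<Theta> d \<theta>0 \<epsilon>. ennreal (likelihood_ratio p \<theta>0 n \<theta> x) \<le> ennreal (exp (- c * real n * \<epsilon>\<^sup>2))"
proof -
  from assms obtain c1 c2 where c: "c1 > 0" "c2 > 0" and A: "\<And>\<epsilon>. \<epsilon> > 0 \<Longrightarrow> \<exists>t>0. \<forall>n\<ge>1.
        outer_measure_of P0
          {x\<in>space P0. (SUP \<theta>\<in>\<Theta> - d_ball \<Theta> d \<theta>0 \<epsilon>. ennreal (likelihood_ratio p \<theta>0 n \<theta> x))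
             \<ge> ennreal (exp (- c1 * real n * \<epsilon>\<^sup>2))}
        \<le> ennreal (c2 * (real n * \<epsilon>\<^sup>2) powr (- (1 + t)))"
    unfolding condition_A1_def by blast
  show ?thesis
  proof (rule that[OF c(1)])
    fix \<epsilon> :: real assume \<epsilon>: "\<epsilon> > 0"
    define B where "B n = {x\<in>space P0. (SUP \<theta>\<in>\<Theta> - d_ball \<Theta> d \<theta>0 \<epsilon>. ennreal (likelihood_ratio p \<theta>0 n \<theta> x))
             \<ge> ennreal (exp (- c1 * real n * \<epsilon>\<^sup>2))}" for n
    from A[OF \<epsilon>] obtain t where t: "t > 0" and le: "\<And>n. n \<ge> 1 \<Longrightarrow>
      outer_measure_of P0 (B n) \<le> ennreal (c2 * (real n * \<epsilon>\<^sup>2) powr (- (1 + t)))"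
      unfolding B_def by blast
    have "summable (\<lambda>n. c2 * (real n * \<epsilon>\<^sup>2) powr (- (1 + t)))"
      using t by (simp add: powr_mult summable_real_powr_iff summable_mult summable_mult2)
    \<comment> \<open>(A1) speaks of \<open>n \<ge> 1\<close> only, so Borel-Cantelli runs along
      \<open>Suc n\<close> and the index is shifted back afterwards.\<close>
    then have sum: "summable (\<lambda>n. c2 * (real (Suc n) * \<epsilon>\<^sup>2) powr (- (1 + t)))"
      by (subst summable_Suc_iff)
    have "AE x in P0. \<forall>\<^sub>F n in sequentially. x \<notin> B (Suc n)"
    proof (rule AE_eventually_not_outer_measure_of[OF _ _ _ sum])
      show "B (Suc n) \<subseteq> space P0" for n by (auto simp: B_def)
      show "outer_measure_of P0 (B (Suc n)) \<le> ennreal (c2 * (real (Suc n) * \<epsilon>\<^sup>2) powr (- (1 + t)))" for n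
        by (rule le) simp
      show "0 \<le> c2 * (real (Suc n) * \<epsilon>\<^sup>2) powr (- (1 + t))" for n
        using c by simp
    qed
    with AE_space show "AE x in P0. \<forall>\<^sub>F n in sequentially.
      \<forall>\<theta>\<in>\<Theta> - d_ball \<Theta> d \<theta>0 \<epsilon>. ennreal (likelihood_ratio p \<theta>0 n \<theta> x) \<le> ennreal (exp (- c1 * real n * \<epsilon>\<^sup>2))"
    proof eventually_elim
      case (elim x)
      then have "\<forall>\<^sub>F n in sequentially. x \<notin> B n"
        using eventually_sequentially_Suc[of "\<lambda>n. x \<notin> B n"] by simp
      then show ?case
      proof eventually_elim
        case (elim n)
        with \<open>x \<in> space P0\<close> have "(SUP \<theta>\<in>\<Theta> - d_ball \<Theta> d \<theta>0 \<epsilon>. ennreal (likelihood_ratio p \<theta>0 n \<theta> x))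
             \<le> ennreal (exp (- c1 * real n * \<epsilon>\<^sup>2))"
          by (auto simp: B_def)
        then show ?case by (auto simp: SUP_le_iff)
      qed
    qed
  qed
qed

section \<open>Integral inequalities behind the bounds on marginals and posteriors\<close>

text \<open>At each point \<open>q * f\<close> is at most \<open>C * (q * f0)\<close> or at most
  \<open>b * f\<close>, hence at most their sum. Using the sum everywhere avoids cutting the space
  into regions, and the second term integrates to \<open>b\<close> because \<open>f\<close> has
  integral 1.\<close>

lemma nn_integral_mult_le_split:
  fixes q f f0 :: "'a \<Rightarrow> real"
  assumes [measurable]: "q \<in> borel_measurable M" "f \<in> borel_measurable M" "f0 \<in> borel_measurable M"
    and nonneg: "\<And>\<theta>. \<theta> \<in> space M \<Longrightarrow> 0 \<le> q \<theta>" "\<And>\<theta>. \<theta> \<in> space M \<Longrightarrow> 0 \<le> f \<theta>"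
      "\<And>\<theta>. \<theta> \<in> space M \<Longrightarrow> 0 \<le> f0 \<theta>"
    and f: "(\<integral>\<^sup>+\<theta>. ennreal (f \<theta>) \<partial>M) = 1" and "0 \<le> C" "0 \<le> b"
    and split: "\<And>\<theta>. \<theta> \<in> space M \<Longrightarrow> f \<theta> \<le> C * f0 \<theta> \<or> q \<theta> \<le> b"
  shows "(\<integral>\<^sup>+\<theta>. ennreal (q \<theta> * f \<theta>) \<partial>M) \<le> ennreal C * (\<integral>\<^sup>+\<theta>. ennreal (q \<theta> * f0 \<theta>) \<partial>M) + ennreal b"
proof -
  have "(\<integral>\<^sup>+\<theta>. ennreal (q \<theta> * f \<theta>) \<partial>M)
      \<le> (\<integral>\<^sup>+\<theta>. ennreal C * ennreal (q \<theta> * f0 \<theta>) + ennreal b * ennreal (f \<theta>) \<partial>M)"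
  proof (rule nn_integral_mono)
    fix \<theta> assume \<theta>: "\<theta> \<in> space M"
    have "q \<theta> * f \<theta> \<le> C * (q \<theta> * f0 \<theta>) + b * f \<theta>"
      using split[OF \<theta>]
    proof
      assume "f \<theta> \<le> C * f0 \<theta>"
      from mult_left_mono[OF this nonneg(1)[OF \<theta>]] show ?thesis
        using mult_nonneg_nonneg[OF \<open>0 \<le> b\<close> nonneg(2)[OF \<theta>]] by (simp add: mult_ac)
    next
      assume "q \<theta> \<le> b"
      from mult_right_mono[OF this nonneg(2)[OF \<theta>]] show ?thesis
        using nonneg[OF \<theta>] \<open>0 \<le> C\<close> by (simp add: add_increasing)
    qed
    then have "ennreal (q \<theta> * f \<theta>) \<le> ennreal (C * (q \<theta> * f0 \<theta>) + b * f \<theta>)"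
      by (rule ennreal_leI)
    also have "\<dots> = ennreal C * ennreal (q \<theta> * f0 \<theta>) + ennreal b * ennreal (f \<theta>)"
      using nonneg[OF \<theta>] \<open>0 \<le> C\<close> \<open>0 \<le> b\<close> by (simp add: ennreal_plus ennreal_mult)
    finally show "ennreal (q \<theta> * f \<theta>) \<le> ennreal C * ennreal (q \<theta> * f0 \<theta>) + ennreal b * ennreal (f \<theta>)" .
  qed
  also have "\<dots> = ennreal C * (\<integral>\<^sup>+\<theta>. ennreal (q \<theta> * f0 \<theta>) \<partial>M) + ennreal b"
    using f by (simp add: nn_integral_add nn_integral_cmult)
  finally show ?thesis .
qed

lemma nn_integral_normalized:
  fixes h :: "'a \<Rightarrow> real"
  assumes [measurable]: "h \<in> borel_measurable M"
    and "\<And>\<theta>. \<theta> \<in> space M \<Longrightarrow> 0 \<le> h \<theta>" "(\<integral>\<^sup>+\<theta>. ennreal (h \<theta>) \<partial>M) = ennreal m" "0 < m"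
  shows "(\<integral>\<^sup>+\<theta>. ennreal (h \<theta> / m) \<partial>M) = 1"
proof -
  have "(\<integral>\<^sup>+\<theta>. ennreal (h \<theta> / m) \<partial>M) = (\<integral>\<^sup>+\<theta>. ennreal (h \<theta>) * ennreal (inverse m) \<partial>M)"
    using assms(2,4) by (intro nn_integral_cong) (simp add: ennreal_mult[symmetric] field_simps)
  also have "\<dots> = ennreal m * ennreal (inverse m)"
    using assms(3) by (simp add: nn_integral_multc)
  also have "\<dots> = 1"
    using assms(4) by (simp add: ennreal_mult[symmetric])
  finally show ?thesis .
qed

text \<open>Two probability densities satisfy \<open>\<bar>a - a0\<bar> + a = 2 max 0 (a - a0) + a0\<close>, so their \<open>L\<^sub>1\<close> distance
  is twice the integral of the positive part of the difference; only an upper bound on \<open>a\<close> is needed.\<close>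

lemma L1_distance_normalized_le:
  fixes q f f0 :: "'a \<Rightarrow> real"
  assumes [measurable]: "q \<in> borel_measurable M" "f \<in> borel_measurable M" "f0 \<in> borel_measurable M"
    and nonneg: "\<And>\<theta>. \<theta> \<in> space M \<Longrightarrow> 0 \<le> q \<theta>" "\<And>\<theta>. \<theta> \<in> space M \<Longrightarrow> 0 \<le> f \<theta>"
      "\<And>\<theta>. \<theta> \<in> space M \<Longrightarrow> 0 \<le> f0 \<theta>"
    and f: "(\<integral>\<^sup>+\<theta>. ennreal (f \<theta>) \<partial>M) = 1" and "0 \<le> \<rho>" "0 \<le> \<kappa>"
    and m: "(\<integral>\<^sup>+\<theta>. ennreal (q \<theta> * f \<theta>) \<partial>M) = ennreal m"
    and m0: "(\<integral>\<^sup>+\<theta>. ennreal (q \<theta> * f0 \<theta>) \<partial>M) = ennreal m0"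
    and m_le: "0 < m0" "m0 \<le> m"
    and split: "\<And>\<theta>. \<theta> \<in> space M \<Longrightarrow> f \<theta> \<le> (1 + \<rho>) * f0 \<theta> \<or> q \<theta> \<le> \<kappa> * m0"
  shows "(\<integral>\<^sup>+\<theta>. ennreal \<bar>q \<theta> * f \<theta> / m - q \<theta> * f0 \<theta> / m0\<bar> \<partial>M) \<le> ennreal (2 * \<rho> + 2 * \<kappa>)"
proof -
  define a where "a \<theta> = q \<theta> * f \<theta> / m" for \<theta>
  define a0 where "a0 \<theta> = q \<theta> * f0 \<theta> / m0" for \<theta>
  have [measurable]: "a \<in> borel_measurable M" "a0 \<in> borel_measurable M"
    by (simp_all add: a_def[abs_def] a0_def[abs_def])
  have "0 < m" using m_le by simp
  have int_a: "(\<integral>\<^sup>+\<theta>. ennreal (a \<theta>) \<partial>M) = 1"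
    unfolding a_def by (rule nn_integral_normalized[OF _ _ m]) (use nonneg \<open>0 < m\<close> in auto)
  have int_a0: "(\<integral>\<^sup>+\<theta>. ennreal (a0 \<theta>) \<partial>M) = 1"
    unfolding a0_def by (rule nn_integral_normalized[OF _ _ m0]) (use nonneg m_le in auto)
  have "(\<integral>\<^sup>+\<theta>. ennreal \<bar>a \<theta> - a0 \<theta>\<bar> \<partial>M) + 1 = (\<integral>\<^sup>+\<theta>. ennreal \<bar>a \<theta> - a0 \<theta>\<bar> + ennreal (a \<theta>) \<partial>M)"
    using int_a by (simp add: nn_integral_add)
  also have "\<dots> \<le> (\<integral>\<^sup>+\<theta>. ennreal (2 * \<rho> + 1) * ennreal (a0 \<theta>) + ennreal (2 * \<kappa>) * ennreal (f \<theta>) \<partial>M)"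
  proof (rule nn_integral_mono)
    fix \<theta> assume \<theta>: "\<theta> \<in> space M"
    note nn = nonneg[OF \<theta>]
    have a: "0 \<le> a \<theta>" "0 \<le> a0 \<theta>" using nn m_le by (auto simp: a_def a0_def)
    \<comment> \<open>This is where \<open>m0 \<le> m\<close> enters: the larger normalizer of
      \<open>a\<close> may be replaced by that of \<open>a0\<close>.\<close>
    have le0: "a \<theta> \<le> q \<theta> * f \<theta> / m0"
      unfolding a_def using nn m_le \<open>0 < m\<close> by (intro divide_left_mono) auto
    have "a \<theta> - a0 \<theta> \<le> \<rho> * a0 \<theta> + \<kappa> * f \<theta>"
      using split[OF \<theta>]
    proof
      assume "f \<theta> \<le> (1 + \<rho>) * f0 \<theta>"
      from mult_left_mono[OF this nn(1)] have "q \<theta> * f \<theta> \<le> (1 + \<rho>) * (q \<theta> * f0 \<theta>)"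
        by (simp add: mult_ac)
      then have "q \<theta> * f \<theta> / m0 \<le> (1 + \<rho>) * (q \<theta> * f0 \<theta>) / m0"
        using m_le(1) by (intro divide_right_mono) auto
      then have "q \<theta> * f \<theta> / m0 \<le> (1 + \<rho>) * a0 \<theta>" by (simp add: a0_def)
      with le0 have "a \<theta> \<le> (1 + \<rho>) * a0 \<theta>" by linarith
      moreover have "0 \<le> \<kappa> * f \<theta>" using nn \<open>0 \<le> \<kappa>\<close> by simp
      ultimately show ?thesis by (simp add: algebra_simps)
    next
      assume "q \<theta> \<le> \<kappa> * m0"
      from mult_right_mono[OF this nn(2)] have "q \<theta> * f \<theta> / m0 \<le> \<kappa> * f \<theta>"
        using m_le(1) by (simp add: field_simps)
      moreover have "0 \<le> \<rho> * a0 \<theta>" using a \<open>0 \<le> \<rho>\<close> by simp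
      ultimately show ?thesis using le0 a by linarith
    qed
    moreover have "0 \<le> \<rho> * a0 \<theta>" "0 \<le> \<kappa> * f \<theta>" using a nn \<open>0 \<le> \<rho>\<close> \<open>0 \<le> \<kappa>\<close> by auto
    \<comment> \<open>If \<open>a \<theta> \<ge> a0 \<theta>\<close>, the left side is twice the
      difference plus \<open>a0 \<theta>\<close>; otherwise it is just \<open>a0 \<theta>\<close>.
      Both cases lie below the bound.\<close>
    ultimately have "\<bar>a \<theta> - a0 \<theta>\<bar> + a \<theta> \<le> (2 * \<rho> + 1) * a0 \<theta> + 2 * \<kappa> * f \<theta>"
      unfolding distrib_right mult.assoc by linarith
    then have "ennreal (\<bar>a \<theta> - a0 \<theta>\<bar> + a \<theta>) \<le> ennreal ((2 * \<rho> + 1) * a0 \<theta> + 2 * \<kappa> * f \<theta>)"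
      by (rule ennreal_leI)
    also have "\<dots> = ennreal (2 * \<rho> + 1) * ennreal (a0 \<theta>) + ennreal (2 * \<kappa>) * ennreal (f \<theta>)"
      using a nn \<open>0 \<le> \<rho>\<close> \<open>0 \<le> \<kappa>\<close>
      by (subst ennreal_plus, simp, simp, subst (1 2) ennreal_mult, auto)
    finally show "ennreal \<bar>a \<theta> - a0 \<theta>\<bar> + ennreal (a \<theta>)
        \<le> ennreal (2 * \<rho> + 1) * ennreal (a0 \<theta>) + ennreal (2 * \<kappa>) * ennreal (f \<theta>)"
      using a by (simp add: ennreal_plus)
  qed
  also have "\<dots> = ennreal (2 * \<rho> + 1) + ennreal (2 * \<kappa>)"
    using f int_a0 by (simp add: nn_integral_add nn_integral_cmult)
  also have "\<dots> = ennreal (2 * \<rho> + 2 * \<kappa>) + 1"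
  proof -
    have "ennreal (2 * \<rho> + 1) + ennreal (2 * \<kappa>) = ennreal ((2 * \<rho> + 2 * \<kappa>) + 1)"
      using \<open>0 \<le> \<rho>\<close> \<open>0 \<le> \<kappa>\<close> by (subst ennreal_plus[symmetric]) (auto simp: algebra_simps)
    also have "\<dots> = ennreal (2 * \<rho> + 2 * \<kappa>) + 1"
      using \<open>0 \<le> \<rho>\<close> \<open>0 \<le> \<kappa>\<close> by (subst ennreal_plus) auto
    finally show ?thesis .
  qed
  finally show ?thesis
    unfolding a_def a0_def add.commute[of _ 1] ennreal_add_left_cancel_le by simp
qed

section \<open>Squeezing in the extended nonnegative reals and the location of maximizers\<close>

lemma tendsto_ennrealI_squeeze:
  fixes f :: "'a \<Rightarrow> ennreal" and c :: ennreal
  assumes "\<forall>\<^sub>F n in F. c \<le> f n" and up: "\<And>e::real. e > 0 \<Longrightarrow> \<forall>\<^sub>F n in F. f n \<le> c + ennreal e"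
    and fin: "c \<noteq> \<infinity>"
  shows "(f \<longlongrightarrow> c) F"
proof (rule order_tendstoI)
  fix a assume "a < c"
  with assms(1) show "\<forall>\<^sub>F n in F. a < f n" by (auto elim: eventually_mono)
next
  fix a assume "c < a"
  then obtain b where b: "c < b" "b < a" using dense by blast
  \<comment> \<open>Since \<open>b\<close> lies strictly between \<open>c\<close> and
    \<open>a\<close>, the gap \<open>b - c\<close> is a positive real, and \<open>c + e\<close> is
    exactly \<open>b\<close>.\<close>
  define e where "e = enn2real (b - c)"
  have bt: "b < \<infinity>" using b(2) by (simp add: order_less_le_trans)
  then have e: "ennreal e = b - c" using b by (simp add: e_def ennreal_enn2real_if)
  have "0 < b - c" using b(1) by (rule diff_gr0_ennreal)
  then have "e > 0" unfolding e[symmetric] by simp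
  from up[OF this] show "\<forall>\<^sub>F n in F. f n < a"
  proof eventually_elim
    case (elim n)
    also have "c + ennreal e = b" using e b fin by (simp add: add_diff_inverse_ennreal)
    finally show ?case using b by simp
  qed
qed

lemma d_set_triangle:
  assumes "Metric_space S dL" "A \<noteq> {}" "A \<subseteq> S" "l \<in> S" "l' \<in> S"
  shows "d_set dL l A \<le> d_set dL l' A + dL l' l"
proof -
  interpret Metric_space S dL by fact
  have "d_set dL l A - dL l' l \<le> d_set dL l' A"
    unfolding d_set_def
  proof (rule cINF_greatest[OF \<open>A \<noteq> {}\<close>])
    fix a assume a: "a \<in> A"
    have "(INF a\<in>A. dL l a) \<le> dL l a"
      using a by (intro cINF_lower bdd_belowI2[of _ 0]) auto
    also have "\<dots> \<le> dL l l' + dL l' a"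
      using a assms(3-5) by (intro triangle) auto
    finally show "(INF a\<in>A. dL l a) - dL l' l \<le> dL l' a"
      by (simp add: commute)
  qed
  then show ?thesis by simp
qed

lemma d_set_nonneg:
  assumes "Metric_space S dL" "A \<noteq> {}"
  shows "0 \<le> d_set dL l A"
  using assms unfolding d_set_def by (intro cINF_greatest) (auto simp: Metric_space.nonneg)

text \<open>A maximizer inside \<open>\<Lambda>\<close> has value above \<open>B\<close> and so
  cannot be far from \<open>A\<close>. At a boundary point the same applies to the tail of a
  maximizing sequence, and the triangle inequality carries the bound to the limit; the gap between
  \<open>\<delta>\<close> and \<open>\<delta>'\<close> pays for this passage.\<close>

lemma is_maximizer_d_set_le:
  assumes dL: "Metric_space \<Lambda>c dL" and sub: "A \<noteq> {}" "A \<subseteq> \<Lambda>c" "\<Lambda> \<subseteq> \<Lambda>c" "l \<in> \<Lambda>c"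
    and bdry: "l \<notin> \<Lambda> \<Longrightarrow> ((\<lambda>l'. dL l' l) \<longlongrightarrow> 0) (at l within \<Lambda>)"
    and max: "is_maximizer \<Lambda> m l"
    and far: "\<And>l'. l' \<in> \<Lambda> \<Longrightarrow> \<delta> < d_set dL l' A \<Longrightarrow> m l' \<le> B"
    and B: "B < (SUP l'\<in>\<Lambda>. m l')" and "\<delta> < \<delta>'"
  shows "d_set dL l A \<le> \<delta>'"
proof (cases "l \<in> \<Lambda>")
  case True
  with max have "m l = (SUP l'\<in>\<Lambda>. m l')" by (simp add: is_maximizer_def)
  with far[OF True] B \<open>\<delta> < \<delta>'\<close> show ?thesis by force
next
  case False
  with max obtain s where s: "\<And>j. s j \<in> \<Lambda>" "s \<longlonglongrightarrow> l" "(\<lambda>j. m (s j)) \<longlonglongrightarrow> (SUP l'\<in>\<Lambda>. m l')"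
    by (auto simp: is_maximizer_def)
  \<comment> \<open>The sequence never hits \<open>l\<close>, because it stays in
    \<open>\<Lambda>\<close> and \<open>l\<close> does not belong to it; this gives convergence
    along the punctured filter.\<close>
  have "filterlim s (at l within \<Lambda>) sequentially"
    unfolding filterlim_at using s False by (auto intro!: always_eventually)
  from filterlim_compose[OF bdry[OF False] this]
  have "(\<lambda>j. dL (s j) l) \<longlonglongrightarrow> 0" .
  then have "\<forall>\<^sub>F j in sequentially. dL (s j) l < \<delta>' - \<delta>"
    using \<open>\<delta> < \<delta>'\<close> by (intro order_tendstoD(2)) auto
  moreover have "\<forall>\<^sub>F j in sequentially. B < m (s j)"
    using s(3) B by (rule order_tendstoD(1))
  ultimately have "\<forall>\<^sub>F j in sequentially. d_set dL l A \<le> \<delta>'"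
  proof eventually_elim
    case (elim j)
    have "d_set dL (s j) A \<le> \<delta>"
      using far[OF s(1)[of j]] elim(2) by force
    moreover have "d_set dL l A \<le> d_set dL (s j) A + dL (s j) l"
      using s(1)[of j] sub by (intro d_set_triangle[OF dL]) auto
    ultimately show ?case using elim(1) by linarith
  qed
  then show ?thesis by simp
qed

text \<open>Undoes the quotient in \<open>condition_iii\<close>. Division by
  \<open>\<infinity>\<close> yields 0 and would lose all information, hence the finiteness of
  \<open>b\<close>; at \<open>b = 0\<close> the bound \<open>a \<le> b\<close> settles the
  claim.\<close>

lemma ennreal_le_mult_of_divide_le:
  fixes a b c :: ennreal
  assumes "a / b \<le> c" "a \<le> b" "b < \<infinity>"
  shows "a \<le> c * b"
proof (cases "b = 0")
  case False
  have "a = a / b * b"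
    using False assms(3) by (simp add: ennreal_divide_times)
  also have "\<dots> \<le> c * b" using assms(1) by (rule mult_right_mono) simp
  finally show ?thesis .
qed (use assms in simp)

section \<open>Measurability of the data and positivity of the true density\<close>

lemma measurable_first_obs:
  assumes "sets P0 = sets (PiM UNIV (\<lambda>_. borel))"
  shows "first_obs n \<in> measurable P0 (PiM {..<n} (\<lambda>_. borel))"
proof -
  have "first_obs n \<in> measurable (PiM UNIV (\<lambda>_. borel)) (PiM {..<n} (\<lambda>_. borel))"
    unfolding first_obs_def[abs_def] by (rule measurable_restrict_subset) simp
  then show ?thesis using assms by (simp cong: measurable_cong_sets)
qed

text \<open>A measure with density \<open>q\<close> gives no mass to the set where \<open>q\<close>
  is not positive. Applied at \<open>\<theta>0\<close>, this keeps the denominators of the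
  likelihood ratios away from the default value of division by zero.\<close>

lemma AE_first_obs_density_pos:
  assumes P: "sets P0 = sets (PiM UNIV (\<lambda>_. borel))"
    and sets: "sets N = sets (PiM {..<n} (\<lambda>_. borel))"
    and meas: "q \<in> borel_measurable (PiM {..<n} (\<lambda>_. borel))"
    and dens: "distr P0 (PiM {..<n} (\<lambda>_. borel)) (first_obs n) = density N (\<lambda>x. ennreal (q x))"
  shows "AE x in P0. 0 < q (first_obs n x)"
proof -
  have fo: "first_obs n \<in> measurable P0 (PiM {..<n} (\<lambda>_. borel))"
    by (rule measurable_first_obs[OF P])
  have meas': "q \<in> borel_measurable N"
    using meas sets by (simp cong: measurable_cong_sets)
  have "AE y in density N (\<lambda>x. ennreal (q x)). 0 < q y"
    using meas' by (subst AE_density) auto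
  then have "AE y in distr P0 (PiM {..<n} (\<lambda>_. borel)) (first_obs n). 0 < q y"
    unfolding dens .
  then show ?thesis
    using fo meas by (subst (asm) AE_distr_iff) auto
qed

section \<open>The model under the true law, with parameter space \<open>space \<nu>\<close>\<close>

locale bayes_model = prob_space P0
  for P0 :: "(nat \<Rightarrow> 'x::topological_space) measure" +
  fixes p :: "nat \<Rightarrow> 't \<Rightarrow> (nat \<Rightarrow> 'x) \<Rightarrow> real" and \<theta>0 :: 't and \<nu> :: "'t measure"
    and \<pi> :: "'l \<Rightarrow> 't \<Rightarrow> real" and \<Lambda> :: "'l set" and d :: "'t \<Rightarrow> 't \<Rightarrow> real"
  assumes sets_P0: "sets P0 = sets (PiM UNIV (\<lambda>_. borel))"
    and p_nonneg: "\<And>n \<theta> y. n \<ge> 1 \<Longrightarrow> \<theta> \<in> space \<nu> \<Longrightarrow> y \<in> space (PiM {..<n} (\<lambda>_. borel)) \<Longrightarrow> 0 \<le> p n \<theta> y"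
    and p_measurable: "\<And>n. n \<ge> 1 \<Longrightarrow>
          (\<lambda>(x, \<theta>). p n \<theta> x) \<in> borel_measurable (PiM {..<n} (\<lambda>_. borel) \<Otimes>\<^sub>M \<nu>)"
    and p_pos: "AE x in P0. \<forall>n\<ge>1. 0 < p n \<theta>0 (first_obs n x)"
    and theta0: "\<theta>0 \<in> space \<nu>"
    and KL_ex: "\<And>\<theta>. \<theta> \<in> space \<nu> \<Longrightarrow> \<exists>c. is_KL_inf P0 p \<theta>0 \<theta> c"
    and KL_ball_measurable: "\<And>\<eta>. \<eta> > 0 \<Longrightarrow> KL_ball (space \<nu>) P0 p \<theta>0 \<eta> \<in> sets \<nu>"
    and pi_nonneg: "\<And>l \<theta>. l \<in> \<Lambda> \<Longrightarrow> \<theta> \<in> space \<nu> \<Longrightarrow> 0 \<le> \<pi> l \<theta>"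
    and pi_measurable: "\<And>l. l \<in> \<Lambda> \<Longrightarrow> \<pi> l \<in> borel_measurable \<nu>"
    and pi_prob: "\<And>l. l \<in> \<Lambda> \<Longrightarrow> prob_space (prior \<nu> \<pi> l)"
    and A1: "condition_A1 (space \<nu>) d P0 p \<theta>0"
begin

lemma first_obs_in_space: "first_obs n x \<in> space (PiM {..<n} (\<lambda>_. borel))"
  by (auto simp: first_obs_def space_PiM)

lemma p_section_measurable:
  assumes "n \<ge> 1"
  shows "(\<lambda>\<theta>. p n \<theta> (first_obs n x)) \<in> borel_measurable \<nu>"
proof -
  have "(\<lambda>\<theta>. (first_obs n x, \<theta>)) \<in> measurable \<nu> (PiM {..<n} (\<lambda>_. borel) \<Otimes>\<^sub>M \<nu>)"
    by (intro measurable_Pair measurable_const first_obs_in_space measurable_ident_sets refl)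
  from measurable_compose[OF this p_measurable[OF assms]] show ?thesis by simp
qed

text \<open>Measurability is joint in path and parameter, as Fubini requires.\<close>

lemma likelihood_ratio_measurable:
  assumes "n \<ge> 1"
  shows "(\<lambda>z. likelihood_ratio p \<theta>0 n (snd z) (fst z)) \<in> borel_measurable (P0 \<Otimes>\<^sub>M \<nu>)"
proof -
  have f: "(\<lambda>z. first_obs n (fst z)) \<in> measurable (P0 \<Otimes>\<^sub>M \<nu>) (PiM {..<n} (\<lambda>_. borel))"
    by (rule measurable_compose[OF measurable_fst measurable_first_obs[OF sets_P0]])
  have 1: "(\<lambda>z. (first_obs n (fst z), snd z)) \<in> measurable (P0 \<Otimes>\<^sub>M \<nu>) (PiM {..<n} (\<lambda>_. borel) \<Otimes>\<^sub>M \<nu>)"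
    by (intro measurable_Pair f measurable_snd)
  have 2: "(\<lambda>z. (first_obs n (fst z), \<theta>0)) \<in> measurable (P0 \<Otimes>\<^sub>M \<nu>) (PiM {..<n} (\<lambda>_. borel) \<Otimes>\<^sub>M \<nu>)"
    using theta0 by (intro measurable_Pair f measurable_const)
  show ?thesis
    unfolding likelihood_ratio_def
    using measurable_compose[OF 1 p_measurable[OF assms]] measurable_compose[OF 2 p_measurable[OF assms]]
    by (intro borel_measurable_divide) simp_all
qed

lemma sets_prior: "sets (prior \<nu> \<pi> l) = sets \<nu>" and space_prior: "space (prior \<nu> \<pi> l) = space \<nu>"
  by (simp_all add: prior_def)

lemma marginal_eq_nn_integral_prior:
  assumes "n \<ge> 1" "l \<in> \<Lambda>"
  shows "marginal \<nu> p \<pi> n x l = (\<integral>\<^sup>+\<theta>. ennreal (p n \<theta> (first_obs n x)) \<partial>prior \<nu> \<pi> l)"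
  unfolding marginal_def prior_def
  using p_section_measurable[OF assms(1)] pi_measurable[OF assms(2)] pi_nonneg[OF assms(2)]
  by (subst nn_integral_density)
     (auto intro!: nn_integral_cong simp: ennreal_mult[symmetric] mult.commute
        p_nonneg[OF assms(1) _ first_obs_in_space])

lemma pi_integral: "l \<in> \<Lambda> \<Longrightarrow> (\<integral>\<^sup>+\<theta>. ennreal (\<pi> l \<theta>) \<partial>\<nu>) = 1"
  using prob_space.emeasure_space_1[OF pi_prob[of l]] pi_measurable[of l]
  by (simp add: prior_def emeasure_density cong: nn_integral_cong)

section \<open>Lower bound on the marginal likelihood\<close>

text \<open>The Kullback-Leibler limit has an exceptional null set of paths that depends on
  \<open>\<theta>\<close>. Fubini exchanges the quantifiers: outside one null set of paths,
  prior-almost every \<open>\<theta>\<close> in the ball behaves well.\<close>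

lemma AE_prior_KL_ball_likelihood_ratio:
  assumes "l0 \<in> \<Lambda>" "\<eta> > 0"
  shows "AE x in P0. AE \<theta> in prior \<nu> \<pi> l0. \<theta> \<in> KL_ball (space \<nu>) P0 p \<theta>0 \<eta> \<longrightarrow>
    (\<forall>\<^sub>F n in sequentially. exp (- (\<eta> * real (Suc n))) < likelihood_ratio p \<theta>0 (Suc n) \<theta> x)"
proof -
  let ?Q = "prior \<nu> \<pi> l0" and ?K = "KL_ball (space \<nu>) P0 p \<theta>0 \<eta>"
  interpret Q: prob_space ?Q by (rule pi_prob[OF assms(1)])
  \<comment> \<open>The exchange is made against the prior, whose total mass 1 supplies
    sigma-finiteness.\<close>
  interpret PQ: pair_sigma_finite P0 ?Q ..
  have sets_eq: "sets (P0 \<Otimes>\<^sub>M ?Q) = sets (P0 \<Otimes>\<^sub>M \<nu>)"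
    by (intro sets_pair_measure_cong sets_prior refl)
  have [measurable]: "(\<lambda>z. likelihood_ratio p \<theta>0 (Suc n) (snd z) (fst z)) \<in> borel_measurable (P0 \<Otimes>\<^sub>M \<nu>)" for n
    by (rule likelihood_ratio_measurable) simp
  note [measurable] = KL_ball_measurable[OF assms(2)]
  \<comment> \<open>Measurability is shown over \<open>\<nu>\<close> with the eventual statement
    spelled out in countable quantifiers, then transferred to the prior, which has the same
    measurable sets.\<close>
  have "{z \<in> space (P0 \<Otimes>\<^sub>M \<nu>). snd z \<in> ?K \<longrightarrow> (\<exists>N. \<forall>n. N \<le> n \<longrightarrow>
     exp (- (\<eta> * real (Suc n))) < likelihood_ratio p \<theta>0 (Suc n) (snd z) (fst z))} \<in> sets (P0 \<Otimes>\<^sub>M \<nu>)"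
    by measurable
  then have meas: "{z \<in> space (P0 \<Otimes>\<^sub>M ?Q). snd z \<in> ?K \<longrightarrow> (\<forall>\<^sub>F n in sequentially.
     exp (- (\<eta> * real (Suc n))) < likelihood_ratio p \<theta>0 (Suc n) (snd z) (fst z))} \<in> sets (P0 \<Otimes>\<^sub>M ?Q)"
    unfolding sets_eq sets_eq_imp_space_eq[OF sets_eq] eventually_sequentially .
  have "AE x in P0. \<theta> \<in> ?K \<longrightarrow> (\<forall>\<^sub>F n in sequentially. exp (- (\<eta> * real (Suc n))) < likelihood_ratio p \<theta>0 (Suc n) \<theta> x)" for \<theta>
  proof (cases "\<theta> \<in> ?K")
    case True
    then have \<theta>: "\<theta> \<in> space \<nu>" "KL_inf P0 p \<theta>0 \<theta> < ereal \<eta>" by (auto simp: KL_ball_def)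
    from KL_inf_less_AE_likelihood_ratio[OF prob_space_axioms KL_ex[OF \<theta>(1)] \<theta>(2)]
    show ?thesis
      by eventually_elim
         (use eventually_sequentially_Suc[of "\<lambda>n. exp (- (\<eta> * real n)) < likelihood_ratio p \<theta>0 n \<theta> _"] in blast)
  qed simp
  then show ?thesis
    by (subst PQ.AE_commute[OF meas]) simp
qed

text \<open>\<open>T n\<close> collects the parameters of the ball whose likelihood ratio at
  \<open>Suc n\<close> is large. Prior-almost every point of the ball is eventually in
  \<open>T n\<close>, so Fatou keeps the prior mass of \<open>T n\<close> away from 0, and
  integrating the likelihood over \<open>T n\<close> alone gives the bound. The constant may depend
  on the path.\<close>

lemma marginal_lower_bound:
  assumes l0: "l0 \<in> \<Lambda>" and \<eta>: "\<eta> > 0"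
    and pos: "emeasure (prior \<nu> \<pi> l0) (KL_ball (space \<nu>) P0 p \<theta>0 \<eta>) > 0"
  shows "AE x in P0. \<exists>c>0. \<forall>\<^sub>F n in sequentially.
    ennreal (c * (p n \<theta>0 (first_obs n x) * exp (- (\<eta> * real n)))) \<le> marginal \<nu> p \<pi> n x l0"
  using AE_prior_KL_ball_likelihood_ratio[OF l0 \<eta>] p_pos
proof eventually_elim
  case (elim x)
  let ?Q = "prior \<nu> \<pi> l0" and ?K = "KL_ball (space \<nu>) P0 p \<theta>0 \<eta>"
  interpret Q: prob_space ?Q by (rule pi_prob[OF l0])
  define T where "T n = {\<theta> \<in> space \<nu>. \<theta> \<in> ?K \<and>
    exp (- (\<eta> * real (Suc n))) < likelihood_ratio p \<theta>0 (Suc n) \<theta> x}" for n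
  note [measurable] = KL_ball_measurable[OF \<eta>]
  have T: "T n \<in> sets ?Q" for n
  proof -
    have [measurable]: "(\<lambda>\<theta>. p (Suc n) \<theta> (first_obs (Suc n) x)) \<in> borel_measurable \<nu>"
      by (rule p_section_measurable) simp
    have "T n \<in> sets \<nu>"
      unfolding T_def likelihood_ratio_def by measurable
    then show ?thesis by (simp add: sets_prior)
  qed
  have "emeasure ?Q ?K = (\<integral>\<^sup>+\<theta>. indicator ?K \<theta> \<partial>?Q)"
    using KL_ball_measurable[OF \<eta>] by (simp add: sets_prior)
  also have "\<dots> \<le> (\<integral>\<^sup>+\<theta>. liminf (\<lambda>n. indicator (T n) \<theta>) \<partial>?Q)"
  proof (rule nn_integral_mono_AE)
    show "AE \<theta> in ?Q. indicator ?K \<theta> \<le> liminf (\<lambda>n. indicator (T n) \<theta> :: ennreal)"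
      using elim(1) AE_space
    proof eventually_elim
      case (elim \<theta>)
      show ?case
      proof (cases "\<theta> \<in> ?K")
        case True
        with elim have "\<forall>\<^sub>F n in sequentially. \<theta> \<in> T n"
          by (auto simp: T_def space_prior elim: eventually_mono)
        then show ?thesis
          by (intro Liminf_bounded) (auto simp: True elim: eventually_mono)
      qed simp
    qed
  qed
  also have "\<dots> \<le> liminf (\<lambda>n. \<integral>\<^sup>+\<theta>. indicator (T n) \<theta> \<partial>?Q)"
    using T by (intro nn_integral_liminf) simp
  finally have "0 < liminf (\<lambda>n. emeasure ?Q (T n))"
    using pos T by (simp add: order_less_le_trans)
  \<comment> \<open>Any number strictly below the limit inferior is eventually exceeded by the
    masses.\<close>
  then obtain c' where c': "0 < c'" "c' < liminf (\<lambda>n. emeasure ?Q (T n))"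
    using dense by blast
  obtain c where c: "c' = ennreal c" "c > 0"
  proof (cases c' rule: ennreal_cases)
    case (real r)
    with c'(1) show ?thesis by (intro that[of r]) auto
  qed (use c' in auto)
  have "\<forall>\<^sub>F n in sequentially. ennreal (c * (p (Suc n) \<theta>0 (first_obs (Suc n) x) * exp (- (\<eta> * real (Suc n)))))
     \<le> marginal \<nu> p \<pi> (Suc n) x l0"
    using less_LiminfD[OF c'(2)]
  proof eventually_elim
    case (elim n)
    let ?p0 = "p (Suc n) \<theta>0 (first_obs (Suc n) x)"
    let ?b = "?p0 * exp (- (\<eta> * real (Suc n)))"
    have p0: "0 < ?p0"
      using \<open>\<forall>n\<ge>1. 0 < p n \<theta>0 (first_obs n x)\<close> by simp
    have "ennreal (c * ?b) = ennreal ?b * c'"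
      using c p0 by (simp add: ennreal_mult mult.commute)
    also have "\<dots> \<le> ennreal ?b * emeasure ?Q (T n)"
      using elim by (intro mult_left_mono) auto
    also have "\<dots> = (\<integral>\<^sup>+\<theta>. ennreal ?b * indicator (T n) \<theta> \<partial>?Q)"
      using T by (simp add: nn_integral_cmult_indicator)
    also have "\<dots> \<le> (\<integral>\<^sup>+\<theta>. ennreal (p (Suc n) \<theta> (first_obs (Suc n) x)) \<partial>?Q)"
    proof (rule nn_integral_mono)
      fix \<theta>
      show "ennreal ?b * indicator (T n) \<theta> \<le> ennreal (p (Suc n) \<theta> (first_obs (Suc n) x))"
      proof (cases "\<theta> \<in> T n")
        case True
        then have "exp (- (\<eta> * real (Suc n))) < p (Suc n) \<theta> (first_obs (Suc n) x) / ?p0"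
          by (simp add: T_def likelihood_ratio_def)
        then have "?b \<le> p (Suc n) \<theta> (first_obs (Suc n) x)"
          using p0 by (simp add: pos_less_divide_eq mult.commute)
        with True show ?thesis by (simp add: ennreal_leI)
      qed simp
    qed
    also have "\<dots> = marginal \<nu> p \<pi> (Suc n) x l0"
      using l0 by (simp add: marginal_eq_nn_integral_prior)
    finally show ?case .
  qed
  then have "\<forall>\<^sub>F n in sequentially. ennreal (c * (p n \<theta>0 (first_obs n x) * exp (- (\<eta> * real n))))
     \<le> marginal \<nu> p \<pi> n x l0"
    by (subst (asm) eventually_sequentially_Suc)
  with c(2) show ?case by blast
qed

section \<open>Negligibility of the likelihood away from the true parameter\<close>

lemma AE_far_likelihood_negligible_fixed:
  assumes l0: "l0 \<in> \<Lambda>" and \<epsilon>: "\<epsilon> > 0"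
    and pos: "\<And>\<eta>. \<eta> > 0 \<Longrightarrow> emeasure (prior \<nu> \<pi> l0) (KL_ball (space \<nu>) P0 p \<theta>0 \<eta>) > 0"
  shows "AE x in P0. \<forall>\<kappa>>0. \<forall>\<^sub>F n in sequentially. 0 < marginal \<nu> p \<pi> n x l0 \<and>
    (\<forall>\<theta>\<in>space \<nu> - d_ball (space \<nu>) d \<theta>0 \<epsilon>.
       ennreal (p n \<theta> (first_obs n x)) \<le> ennreal \<kappa> * marginal \<nu> p \<pi> n x l0)"
proof -
  from condition_A1_AE[OF A1] obtain c1 where "c1 > 0" and
    A: "AE x in P0. \<forall>\<^sub>F n in sequentially. \<forall>\<theta>\<in>space \<nu> - d_ball (space \<nu>) d \<theta>0 \<epsilon>.
      ennreal (likelihood_ratio p \<theta>0 n \<theta> x) \<le> ennreal (exp (- c1 * real n * \<epsilon>\<^sup>2))"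
    using \<epsilon> by blast
  \<comment> \<open>Half the decay rate of (A1): the far likelihood decays like
    \<open>exp (- 2 * \<eta> * n)\<close> relative to that of \<open>\<theta>0\<close>, the marginal
    at worst like \<open>exp (- \<eta> * n)\<close>, so a factor \<open>exp (- \<eta> * n)\<close>
    is left to beat \<open>\<kappa> * c\<close>.\<close>
  define \<eta> where "\<eta> = c1 * \<epsilon>\<^sup>2 / 2"
  have \<eta>: "\<eta> > 0" using \<epsilon> \<open>c1 > 0\<close> by (simp add: \<eta>_def)
  show ?thesis
    using A marginal_lower_bound[OF l0 \<eta> pos[OF \<eta>]] p_pos
  proof eventually_elim
    case (elim x)
    from elim(2) obtain c where c: "c > 0" and lower: "\<forall>\<^sub>F n in sequentially.
      ennreal (c * (p n \<theta>0 (first_obs n x) * exp (- (\<eta> * real n)))) \<le> marginal \<nu> p \<pi> n x l0"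
      by blast
    show ?case
    proof (intro allI impI)
      fix \<kappa> :: real assume \<kappa>: "\<kappa> > 0"
      have "(\<lambda>n. exp (- (\<eta> * real n))) \<longlonglongrightarrow> 0"
        using \<eta> by real_asymp
      then have "\<forall>\<^sub>F n in sequentially. exp (- (\<eta> * real n)) < \<kappa> * c"
        using \<kappa> c by (intro order_tendstoD(2)) auto
      with elim(1) lower eventually_ge_at_top[of 1]
      show "\<forall>\<^sub>F n in sequentially. 0 < marginal \<nu> p \<pi> n x l0 \<and>
        (\<forall>\<theta>\<in>space \<nu> - d_ball (space \<nu>) d \<theta>0 \<epsilon>.
           ennreal (p n \<theta> (first_obs n x)) \<le> ennreal \<kappa> * marginal \<nu> p \<pi> n x l0)"
      proof eventually_elim
        case (elim n)
        let ?p0 = "p n \<theta>0 (first_obs n x)" and ?e = "exp (- (\<eta> * real n))"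
        have p0: "0 < ?p0"
          using \<open>\<forall>n\<ge>1. 0 < p n \<theta>0 (first_obs n x)\<close> elim by simp
        have "0 < ennreal (c * (?p0 * ?e))" using c p0 by simp
        also note elim(2)
        finally have "0 < marginal \<nu> p \<pi> n x l0" .
        moreover have "ennreal (p n \<theta> (first_obs n x)) \<le> ennreal \<kappa> * marginal \<nu> p \<pi> n x l0"
          if \<theta>: "\<theta> \<in> space \<nu> - d_ball (space \<nu>) d \<theta>0 \<epsilon>" for \<theta>
        proof -
          have "exp (- c1 * real n * \<epsilon>\<^sup>2) = ?e * ?e"
            unfolding exp_add[symmetric] by (simp add: \<eta>_def algebra_simps)
          with elim(1) \<theta> have "likelihood_ratio p \<theta>0 n \<theta> x \<le> ?e * ?e"
            by (fastforce simp: ennreal_le_iff2)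
          then have "p n \<theta> (first_obs n x) \<le> ?e * (?p0 * ?e)"
            using p0 by (simp add: likelihood_ratio_def field_simps)
          also have "\<dots> \<le> \<kappa> * c * (?p0 * ?e)"
            using elim(4) p0 by (intro mult_right_mono) auto
          finally have "ennreal (p n \<theta> (first_obs n x)) \<le> ennreal (\<kappa> * (c * (?p0 * ?e)))"
            by (intro ennreal_leI) (simp add: mult.assoc)
          also have "\<dots> = ennreal \<kappa> * ennreal (c * (?p0 * ?e))"
            using \<kappa> c p0 by (simp add: ennreal_mult)
          also have "\<dots> \<le> ennreal \<kappa> * marginal \<nu> p \<pi> n x l0"
            using elim(2) by (intro mult_left_mono) auto
          finally show ?thesis .
        qed
        ultimately show ?case by blast
      qed
    qed
  qed
qed

text \<open>Bundles all that is needed almost surely about \<open>l0\<close>, so that the asymptotic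
  arguments can be carried out for one fixed path.\<close>

definition far_negligible :: "'l \<Rightarrow> (nat \<Rightarrow> 'x) \<Rightarrow> bool" where
  "far_negligible l0 x \<longleftrightarrow> (\<forall>\<epsilon>>0. \<forall>\<kappa>>0. \<forall>\<^sub>F n in sequentially. 0 < marginal \<nu> p \<pi> n x l0 \<and>
    (\<forall>\<theta>\<in>space \<nu> - d_ball (space \<nu>) d \<theta>0 \<epsilon>.
       ennreal (p n \<theta> (first_obs n x)) \<le> ennreal \<kappa> * marginal \<nu> p \<pi> n x l0))"

text \<open>The radii \<open>1 / (k + 1)\<close> suffice, since a smaller ball has a larger
  complement; this leaves countably many null sets. All \<open>\<kappa>\<close> already share one
  null set.\<close>

lemma AE_far_negligible:
  assumes l0: "l0 \<in> \<Lambda>"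
    and pos: "\<And>\<eta>. \<eta> > 0 \<Longrightarrow> emeasure (prior \<nu> \<pi> l0) (KL_ball (space \<nu>) P0 p \<theta>0 \<eta>) > 0"
  shows "AE x in P0. far_negligible l0 x"
proof -
  have "AE x in P0. \<forall>k. \<forall>\<kappa>>0. \<forall>\<^sub>F n in sequentially. 0 < marginal \<nu> p \<pi> n x l0 \<and>
    (\<forall>\<theta>\<in>space \<nu> - d_ball (space \<nu>) d \<theta>0 (inverse (real (Suc k))).
       ennreal (p n \<theta> (first_obs n x)) \<le> ennreal \<kappa> * marginal \<nu> p \<pi> n x l0)"
    unfolding AE_all_countable
    by (intro allI AE_far_likelihood_negligible_fixed l0 pos) simp_all
  then show ?thesis
  proof eventually_elim
    case (elim x)
    show ?case
      unfolding far_negligible_def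
    proof (intro allI impI)
      fix \<epsilon> \<kappa> :: real assume "\<epsilon> > 0" "\<kappa> > 0"
      then obtain k where "inverse (real (Suc k)) < \<epsilon>" using reals_Archimedean by blast
      then have sub: "d_ball (space \<nu>) d \<theta>0 (inverse (real (Suc k))) \<subseteq> d_ball (space \<nu>) d \<theta>0 \<epsilon>"
        by (intro d_ball_mono) simp
      show "\<forall>\<^sub>F n in sequentially. 0 < marginal \<nu> p \<pi> n x l0 \<and>
        (\<forall>\<theta>\<in>space \<nu> - d_ball (space \<nu>) d \<theta>0 \<epsilon>.
          ennreal (p n \<theta> (first_obs n x)) \<le> ennreal \<kappa> * marginal \<nu> p \<pi> n x l0)"
        using elim[rule_format, OF \<open>\<kappa> > 0\<close>, of k] by eventually_elim (use sub in blast)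
    qed
  qed
qed

section \<open>Local comparison of priors and convergence of the marginal ratio\<close>

lemma prior_le_sup_prior: "l \<in> \<Lambda> \<Longrightarrow> ennreal (\<pi> l \<theta>) \<le> sup_prior \<Lambda> \<pi> \<theta>"
  unfolding sup_prior_def by (rule SUP_upper)

text \<open>The constant \<open>c\<close> separates the common value
  \<open>g(\<theta>0) = \<pi> l0 \<theta>0\<close> from
  \<open>(1 + \<rho>) * \<pi> l0 \<theta>0\<close>. Near \<open>\<theta>0\<close>, continuity keeps
  the supremum below \<open>c\<close> and \<open>(1 + \<rho>) * \<pi> l0\<close> above it.\<close>

lemma sup_prior_local_bound:
  assumes l0: "l0 \<in> Lambda0 \<Lambda> \<pi> \<theta>0" "d_continuous_at (space \<nu>) d \<theta>0 (\<pi> l0)"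
    and g: "sup_prior \<Lambda> \<pi> \<theta>0 > 0" "d_continuous_at (space \<nu>) d \<theta>0 (sup_prior \<Lambda> \<pi>)"
    and \<rho>: "\<rho> > 0"
  obtains \<epsilon> where "\<epsilon> > 0"
    "\<And>\<theta>. \<theta> \<in> d_ball (space \<nu>) d \<theta>0 \<epsilon> \<Longrightarrow> sup_prior \<Lambda> \<pi> \<theta> \<le> ennreal ((1 + \<rho>) * \<pi> l0 \<theta>)"
proof -
  have g0: "sup_prior \<Lambda> \<pi> \<theta>0 = ennreal (\<pi> l0 \<theta>0)" using l0 by (simp add: Lambda0_def)
  with g have pos: "0 < \<pi> l0 \<theta>0" by simp
  define c where "c = (1 + \<rho> / 2) * \<pi> l0 \<theta>0"
  have c: "\<pi> l0 \<theta>0 < c" "c < (1 + \<rho>) * \<pi> l0 \<theta>0"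
    using pos \<rho> by (simp_all add: c_def)
  have "sup_prior \<Lambda> \<pi> \<theta>0 \<in> {..<ennreal c}"
    using c pos by (simp add: g0 ennreal_less_iff)
  then obtain e1 where e1: "e1 > 0" "\<And>\<theta>. \<theta> \<in> d_ball (space \<nu>) d \<theta>0 e1 \<Longrightarrow> sup_prior \<Lambda> \<pi> \<theta> \<in> {..<ennreal c}"
    using d_continuous_at_eventually[OF g(2) open_lessThan] by blast
  have "\<pi> l0 \<theta>0 \<in> {c / (1 + \<rho>)<..}"
    using c(2) \<rho> by (simp add: pos_divide_less_eq mult.commute)
  then obtain e2 where e2: "e2 > 0" "\<And>\<theta>. \<theta> \<in> d_ball (space \<nu>) d \<theta>0 e2 \<Longrightarrow> \<pi> l0 \<theta> \<in> {c / (1 + \<rho>)<..}"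
    using d_continuous_at_eventually[OF l0(2) open_greaterThan] by blast
  show ?thesis
  proof (rule that[of "min e1 e2"])
    show "min e1 e2 > 0" using e1 e2 by simp
    fix \<theta> assume \<theta>: "\<theta> \<in> d_ball (space \<nu>) d \<theta>0 (min e1 e2)"
    then have "\<theta> \<in> d_ball (space \<nu>) d \<theta>0 e1" "\<theta> \<in> d_ball (space \<nu>) d \<theta>0 e2"
      by (auto simp: d_ball_def)
    with e1(2) e2(2) have "sup_prior \<Lambda> \<pi> \<theta> < ennreal c" "c / (1 + \<rho>) < \<pi> l0 \<theta>" by auto
    moreover from this(2) have "c \<le> (1 + \<rho>) * \<pi> l0 \<theta>"
      using \<rho> by (simp add: pos_divide_less_eq mult.commute)
    ultimately show "sup_prior \<Lambda> \<pi> \<theta> \<le> ennreal ((1 + \<rho>) * \<pi> l0 \<theta>)"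
      by (meson ennreal_leI less_imp_le order_trans)
  qed
qed

lemma marginal_le_split:
  assumes n: "n \<ge> 1" and l: "l \<in> \<Lambda>" "l0 \<in> \<Lambda>" and "0 \<le> C" "0 \<le> b"
    and split: "\<And>\<theta>. \<theta> \<in> space \<nu> \<Longrightarrow> \<pi> l \<theta> \<le> C * \<pi> l0 \<theta> \<or> p n \<theta> (first_obs n x) \<le> b"
  shows "marginal \<nu> p \<pi> n x l \<le> ennreal C * marginal \<nu> p \<pi> n x l0 + ennreal b"
  unfolding marginal_def
  by (rule nn_integral_mult_le_split[OF p_section_measurable[OF n] pi_measurable[OF l(1)] pi_measurable[OF l(2)]])
     (use assms in \<open>auto simp: pi_nonneg pi_integral intro: p_nonneg[OF n _ first_obs_in_space]\<close>)

text \<open>Passage to real numbers: the marginal at \<open>l0\<close> is positive along such a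
  path, and finite because the maximum dominates it.\<close>

lemma far_negligible_real:
  assumes far: "far_negligible l0 x" and "\<epsilon> > 0" "\<kappa> > 0" and l0: "l0 \<in> \<Lambda>"
    and fin: "\<forall>\<^sub>F n in sequentially. max_marginal \<nu> p \<pi> \<Lambda> n x < \<infinity>"
  shows "\<forall>\<^sub>F n in sequentially. n \<ge> 1 \<and> (\<exists>m0 M. 0 < m0 \<and> m0 \<le> M \<and> marginal \<nu> p \<pi> n x l0 = ennreal m0 \<and>
    max_marginal \<nu> p \<pi> \<Lambda> n x = ennreal M \<and>
    (\<forall>\<theta>\<in>space \<nu> - d_ball (space \<nu>) d \<theta>0 \<epsilon>. p n \<theta> (first_obs n x) \<le> \<kappa> * m0))"
  using far[unfolded far_negligible_def, rule_format, OF assms(2,3)] fin eventually_ge_at_top[of 1]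
proof eventually_elim
  case (elim n)
  have le: "marginal \<nu> p \<pi> n x l0 \<le> max_marginal \<nu> p \<pi> \<Lambda> n x"
    unfolding max_marginal_def using l0 by (rule SUP_upper)
  obtain M where M: "max_marginal \<nu> p \<pi> \<Lambda> n x = ennreal M" "0 \<le> M"
    using elim(2) by (cases "max_marginal \<nu> p \<pi> \<Lambda> n x" rule: ennreal_cases) auto
  obtain m0 where m0: "marginal \<nu> p \<pi> n x l0 = ennreal m0" "0 \<le> m0"
    using elim(2) le by (cases "marginal \<nu> p \<pi> n x l0" rule: ennreal_cases) auto
  have "0 < m0" using elim(1) m0 by simp
  moreover have "m0 \<le> M" using le M m0 by simp
  moreover have "p n \<theta> (first_obs n x) \<le> \<kappa> * m0" if "\<theta> \<in> space \<nu> - d_ball (space \<nu>) d \<theta>0 \<epsilon>" for \<theta>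
  proof -
    have "ennreal (p n \<theta> (first_obs n x)) \<le> ennreal (\<kappa> * m0)"
      using elim(1) that m0 \<open>\<kappa> > 0\<close> by (simp add: ennreal_mult)
    then show ?thesis using \<open>\<kappa> > 0\<close> \<open>0 < m0\<close> by (subst (asm) ennreal_le_iff) auto
  qed
  ultimately show ?case using elim(3) m0(1) M(1) by blast
qed

text \<open>The ratio is at least 1 because \<open>l0\<close> competes in the supremum. For the
  upper bound the error \<open>e\<close> is halved: one half for the comparison of priors near
  \<open>\<theta>0\<close>, the other for the far likelihood.\<close>

lemma max_marginal_ratio_tendsto:
  assumes l0: "l0 \<in> Lambda0 \<Lambda> \<pi> \<theta>0" "d_continuous_at (space \<nu>) d \<theta>0 (\<pi> l0)"
    and g: "sup_prior \<Lambda> \<pi> \<theta>0 > 0" "d_continuous_at (space \<nu>) d \<theta>0 (sup_prior \<Lambda> \<pi>)"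
    and far: "far_negligible l0 x"
    and fin: "\<forall>\<^sub>F n in sequentially. max_marginal \<nu> p \<pi> \<Lambda> n x < \<infinity>"
  shows "(\<lambda>n. max_marginal \<nu> p \<pi> \<Lambda> n x / marginal \<nu> p \<pi> n x l0) \<longlonglongrightarrow> 1"
proof (rule tendsto_ennrealI_squeeze)
  have l0': "l0 \<in> \<Lambda>" using l0 by (simp add: Lambda0_def)
  show "\<forall>\<^sub>F n in sequentially. 1 \<le> max_marginal \<nu> p \<pi> \<Lambda> n x / marginal \<nu> p \<pi> n x l0"
    using far_negligible_real[OF far zero_less_one zero_less_one l0' fin]
    by eventually_elim (auto simp: divide_ennreal)
  fix e :: real assume e: "e > 0"
  then obtain \<epsilon> where \<epsilon>: "\<epsilon> > 0"
    "\<And>\<theta>. \<theta> \<in> d_ball (space \<nu>) d \<theta>0 \<epsilon> \<Longrightarrow> sup_prior \<Lambda> \<pi> \<theta> \<le> ennreal ((1 + e / 2) * \<pi> l0 \<theta>)"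
    using sup_prior_local_bound[OF l0 g, of "e / 2"] by auto
  from e have "e / 2 > 0" by simp
  from far_negligible_real[OF far \<epsilon>(1) this l0' fin]
  show "\<forall>\<^sub>F n in sequentially. max_marginal \<nu> p \<pi> \<Lambda> n x / marginal \<nu> p \<pi> n x l0 \<le> 1 + ennreal e"
  proof eventually_elim
    case (elim n)
    then obtain m0 M where n: "n \<ge> 1" and m: "0 < m0" "m0 \<le> M" "marginal \<nu> p \<pi> n x l0 = ennreal m0"
      "max_marginal \<nu> p \<pi> \<Lambda> n x = ennreal M"
      and far: "\<And>\<theta>. \<theta> \<in> space \<nu> - d_ball (space \<nu>) d \<theta>0 \<epsilon> \<Longrightarrow> p n \<theta> (first_obs n x) \<le> e / 2 * m0"
      by blast
    have "marginal \<nu> p \<pi> n x l \<le> ennreal ((1 + e) * m0)" if l: "l \<in> \<Lambda>" for l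
    proof -
      have "marginal \<nu> p \<pi> n x l \<le> ennreal (1 + e / 2) * marginal \<nu> p \<pi> n x l0 + ennreal (e / 2 * m0)"
      proof (rule marginal_le_split[OF n l l0'])
        fix \<theta> assume \<theta>: "\<theta> \<in> space \<nu>"
        show "\<pi> l \<theta> \<le> (1 + e / 2) * \<pi> l0 \<theta> \<or> p n \<theta> (first_obs n x) \<le> e / 2 * m0"
        proof (cases "\<theta> \<in> d_ball (space \<nu>) d \<theta>0 \<epsilon>")
          case True
          have "ennreal (\<pi> l \<theta>) \<le> ennreal ((1 + e / 2) * \<pi> l0 \<theta>)"
            using prior_le_sup_prior[OF l] \<epsilon>(2)[OF True] by (rule order_trans)
          then show ?thesis using pi_nonneg[OF l0' \<theta>] e by (subst (asm) ennreal_le_iff) auto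
        qed (use far \<theta> in auto)
      qed (use e m in auto)
      also have "\<dots> = ennreal ((1 + e / 2) * m0 + e / 2 * m0)"
        using e m by (simp add: ennreal_mult)
      also have "(1 + e / 2) * m0 + e / 2 * m0 = (1 + e) * m0" by (simp add: algebra_simps)
      finally show ?thesis .
    qed
    then have "max_marginal \<nu> p \<pi> \<Lambda> n x \<le> ennreal ((1 + e) * m0)"
      unfolding max_marginal_def by (rule SUP_least)
    then have "M \<le> (1 + e) * m0" using m e by simp
    then have "M / m0 \<le> 1 + e" using m by (simp add: pos_divide_le_eq)
    then have "ennreal (M / m0) \<le> ennreal (1 + e)" by (rule ennreal_leI)
    then show ?case using m e by (simp add: divide_ennreal)
  qed
qed simp

section \<open>Strictly smaller marginals away from \<open>\<Lambda>0\<close>\<close>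

text \<open>Near \<open>\<theta>0\<close> separation gains a factor \<open>1 - h\<close> and the
  local comparison loses only \<open>1 + h / 2\<close>, so \<open>\<pi> l\<close> is at most
  \<open>(1 - h / 2) * \<pi> l0\<close>. The far likelihood adds \<open>h / 4\<close>, leaving the
  factor \<open>1 - h / 4\<close>, the same for all \<open>l\<close> in \<open>L\<close>.\<close>

lemma marginal_away_from_Lambda0:
  assumes l0: "l0 \<in> Lambda0 \<Lambda> \<pi> \<theta>0" "d_continuous_at (space \<nu>) d \<theta>0 (\<pi> l0)"
    and g: "sup_prior \<Lambda> \<pi> \<theta>0 > 0" "d_continuous_at (space \<nu>) d \<theta>0 (sup_prior \<Lambda> \<pi>)"
    and far: "far_negligible l0 x"
    and fin: "\<forall>\<^sub>F n in sequentially. max_marginal \<nu> p \<pi> \<Lambda> n x < \<infinity>"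
    and L: "L \<subseteq> \<Lambda>" and \<epsilon>': "\<epsilon>' > 0" and \<eta>: "\<eta> > 0"
    and sep: "(SUP \<theta>\<in>d_ball (space \<nu>) d \<theta>0 \<epsilon>'. SUP l\<in>L. ennreal (\<pi> l \<theta>) / sup_prior \<Lambda> \<pi> \<theta>) \<le> ennreal (1 - \<eta>)"
  shows "\<exists>s<1. \<forall>\<^sub>F n in sequentially. \<forall>l\<in>L. marginal \<nu> p \<pi> n x l \<le> ennreal s * marginal \<nu> p \<pi> n x l0"
proof -
  have l0': "l0 \<in> \<Lambda>" using l0 by (simp add: Lambda0_def)
  \<comment> \<open>The cap keeps \<open>1 - h\<close> positive, whereas
    \<open>ennreal (1 - \<eta>)\<close> is truncated to 0 once \<open>\<eta>\<close> exceeds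
    1.\<close>
  define h where "h = min \<eta> (1 / 2)"
  have h: "0 < h" "h \<le> 1 / 2" "h \<le> \<eta>" using \<eta> by (auto simp: h_def)
  define C where "C = (1 - h) * (1 + h / 2)"
  have "0 \<le> C" using h by (simp add: C_def)
  moreover have "C \<le> 1 - h / 2" using h by (simp add: C_def algebra_simps)
  ultimately have C: "0 \<le> C" "C \<le> 1 - h / 2" .
  obtain \<epsilon>'' where \<epsilon>'': "\<epsilon>'' > 0"
    "\<And>\<theta>. \<theta> \<in> d_ball (space \<nu>) d \<theta>0 \<epsilon>'' \<Longrightarrow> sup_prior \<Lambda> \<pi> \<theta> \<le> ennreal ((1 + h / 2) * \<pi> l0 \<theta>)"
    using sup_prior_local_bound[OF l0 g, of "h / 2"] h by auto
  define \<epsilon> where "\<epsilon> = min \<epsilon>' \<epsilon>''"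
  have \<epsilon>: "\<epsilon> > 0" using \<epsilon>' \<epsilon>'' by (simp add: \<epsilon>_def)
  have near: "\<pi> l \<theta> \<le> C * \<pi> l0 \<theta>" if l: "l \<in> L" and \<theta>: "\<theta> \<in> d_ball (space \<nu>) d \<theta>0 \<epsilon>" for l \<theta>
  proof -
    have \<theta>': "\<theta> \<in> d_ball (space \<nu>) d \<theta>0 \<epsilon>'" "\<theta> \<in> d_ball (space \<nu>) d \<theta>0 \<epsilon>''" "\<theta> \<in> space \<nu>"
      using \<theta> by (auto simp: d_ball_def \<epsilon>_def)
    have "ennreal (\<pi> l \<theta>) / sup_prior \<Lambda> \<pi> \<theta> \<le> ennreal (1 - \<eta>)"
      using sep \<theta>'(1) l by (auto simp: SUP_le_iff)
    also have "\<dots> \<le> ennreal (1 - h)" using h by (intro ennreal_leI) simp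
    finally have "ennreal (\<pi> l \<theta>) \<le> ennreal (1 - h) * sup_prior \<Lambda> \<pi> \<theta>"
      using l L \<epsilon>''(2)[OF \<theta>'(2)]
      by (intro ennreal_le_mult_of_divide_le prior_le_sup_prior) (auto simp: le_less_trans)
    also have "\<dots> \<le> ennreal (1 - h) * ennreal ((1 + h / 2) * \<pi> l0 \<theta>)"
      using \<epsilon>''(2)[OF \<theta>'(2)] by (intro mult_left_mono) auto
    also have "\<dots> = ennreal (C * \<pi> l0 \<theta>)"
      using h pi_nonneg[OF l0' \<theta>'(3)] by (simp add: C_def ennreal_mult[symmetric] mult.assoc)
    finally show ?thesis
      using C(1) pi_nonneg[OF l0' \<theta>'(3)] by (subst (asm) ennreal_le_iff) auto
  qed
  have "h / 4 > 0" using h by simp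
  from far_negligible_real[OF far \<epsilon> this l0' fin]
  have "\<forall>\<^sub>F n in sequentially. \<forall>l\<in>L. marginal \<nu> p \<pi> n x l \<le> ennreal (1 - h / 4) * marginal \<nu> p \<pi> n x l0"
  proof eventually_elim
    case (elim n)
    then obtain m0 where n: "n \<ge> 1" and m: "0 < m0" "marginal \<nu> p \<pi> n x l0 = ennreal m0"
      and far: "\<And>\<theta>. \<theta> \<in> space \<nu> - d_ball (space \<nu>) d \<theta>0 \<epsilon> \<Longrightarrow> p n \<theta> (first_obs n x) \<le> h / 4 * m0"
      by blast
    show ?case
    proof
      fix l assume l: "l \<in> L"
      have "marginal \<nu> p \<pi> n x l \<le> ennreal C * marginal \<nu> p \<pi> n x l0 + ennreal (h / 4 * m0)"
        using L C h m near[OF l] far by (intro marginal_le_split n subsetD[OF L] l l0') auto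
      also have "\<dots> = ennreal (C * m0 + h / 4 * m0)"
        using C h m by (simp add: ennreal_mult)
      also have "\<dots> \<le> ennreal ((1 - h / 4) * m0)"
      proof (rule ennreal_leI)
        have "C * m0 \<le> (1 - h / 2) * m0" using C m by (intro mult_right_mono) auto
        then show "C * m0 + h / 4 * m0 \<le> (1 - h / 4) * m0" by (simp add: algebra_simps)
      qed
      also have "\<dots> = ennreal (1 - h / 4) * marginal \<nu> p \<pi> n x l0"
        using h m by (simp add: ennreal_mult)
      finally show "marginal \<nu> p \<pi> n x l \<le> ennreal (1 - h / 4) * marginal \<nu> p \<pi> n x l0" .
    qed
  qed
  moreover have "1 - h / 4 < 1" using h by simp
  ultimately show ?thesis by blast
qed

section \<open>Posterior densities and their merging\<close>

lemma posterior_density_prob_space: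
  assumes "n \<ge> 1" "l \<in> \<Lambda>" "0 < marginal \<nu> p \<pi> n x l" "marginal \<nu> p \<pi> n x l < \<infinity>"
  shows "prob_space (density \<nu> (\<lambda>\<theta>. ennreal (posterior_density \<nu> p \<pi> n x l \<theta>)))"
proof
  note [measurable] = p_section_measurable[OF assms(1), of x] pi_measurable[OF assms(2)]
  obtain m where m: "marginal \<nu> p \<pi> n x l = ennreal m" "0 < m"
    using assms(3,4) by (cases "marginal \<nu> p \<pi> n x l" rule: ennreal_cases) auto
  then have post: "posterior_density \<nu> p \<pi> n x l = (\<lambda>\<theta>. p n \<theta> (first_obs n x) * \<pi> l \<theta> / m)"
    by (simp add: posterior_density_def fun_eq_iff)
  have "emeasure (density \<nu> (\<lambda>\<theta>. ennreal (posterior_density \<nu> p \<pi> n x l \<theta>))) (space \<nu>)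
      = (\<integral>\<^sup>+\<theta>. ennreal (p n \<theta> (first_obs n x) * \<pi> l \<theta> / m) \<partial>\<nu>)"
    unfolding post by (subst emeasure_density) (auto intro!: nn_integral_cong)
  also have "\<dots> = 1"
    by (rule nn_integral_normalized[OF _ _ m(1)[unfolded marginal_def] m(2)])
       (use assms p_nonneg[OF assms(1) _ first_obs_in_space] in \<open>auto simp: pi_nonneg\<close>)
  finally show "emeasure (density \<nu> (\<lambda>\<theta>. ennreal (posterior_density \<nu> p \<pi> n x l \<theta>)))
      (space (density \<nu> (\<lambda>\<theta>. ennreal (posterior_density \<nu> p \<pi> n x l \<theta>)))) = 1"
    by simp
qed

lemma posterior_density_L1_tendsto:
  assumes l0: "l0 \<in> Lambda0 \<Lambda> \<pi> \<theta>0" "d_continuous_at (space \<nu>) d \<theta>0 (\<pi> l0)"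
    and g: "sup_prior \<Lambda> \<pi> \<theta>0 > 0" "d_continuous_at (space \<nu>) d \<theta>0 (sup_prior \<Lambda> \<pi>)"
    and far: "far_negligible l0 x"
    and fin: "\<forall>\<^sub>F n in sequentially. max_marginal \<nu> p \<pi> \<Lambda> n x < \<infinity>"
    and l: "\<forall>\<^sub>F n in sequentially. l n \<in> \<Lambda> \<and> marginal \<nu> p \<pi> n x (l n) = max_marginal \<nu> p \<pi> \<Lambda> n x"
  shows "(\<lambda>n. \<integral>\<^sup>+\<theta>. ennreal \<bar>posterior_density \<nu> p \<pi> n x (l n) \<theta> - posterior_density \<nu> p \<pi> n x l0 \<theta>\<bar> \<partial>\<nu>)
    \<longlonglongrightarrow> 0"
proof (rule tendsto_ennrealI_squeeze)
  have l0': "l0 \<in> \<Lambda>" using l0 by (simp add: Lambda0_def)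
  fix e :: real assume "e > 0"
  \<comment> \<open>With \<open>\<kappa> = \<rho>\<close> the bound
    \<open>2 * \<rho> + 2 * \<kappa>\<close> of \<open>L1_distance_normalized_le\<close> equals
    \<open>e\<close>.\<close>
  define \<rho> where "\<rho> = e / 4"
  have \<rho>: "\<rho> > 0" using \<open>e > 0\<close> by (simp add: \<rho>_def)
  obtain \<epsilon> where \<epsilon>: "\<epsilon> > 0"
    "\<And>\<theta>. \<theta> \<in> d_ball (space \<nu>) d \<theta>0 \<epsilon> \<Longrightarrow> sup_prior \<Lambda> \<pi> \<theta> \<le> ennreal ((1 + \<rho>) * \<pi> l0 \<theta>)"
    using sup_prior_local_bound[OF l0 g \<rho>] by auto
  from far_negligible_real[OF far \<epsilon>(1) \<rho> l0' fin] l
  show "\<forall>\<^sub>F n in sequentially. (\<integral>\<^sup>+\<theta>. ennreal \<bar>posterior_density \<nu> p \<pi> n x (l n) \<theta>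
      - posterior_density \<nu> p \<pi> n x l0 \<theta>\<bar> \<partial>\<nu>) \<le> 0 + ennreal e"
  proof eventually_elim
    case (elim n)
    then obtain m0 M where n: "n \<ge> 1" and ln: "l n \<in> \<Lambda>" and m: "0 < m0" "m0 \<le> M"
      "marginal \<nu> p \<pi> n x l0 = ennreal m0" "marginal \<nu> p \<pi> n x (l n) = ennreal M"
      and far: "\<And>\<theta>. \<theta> \<in> space \<nu> - d_ball (space \<nu>) d \<theta>0 \<epsilon> \<Longrightarrow> p n \<theta> (first_obs n x) \<le> \<rho> * m0"
      by auto
    have "(\<integral>\<^sup>+\<theta>. ennreal \<bar>p n \<theta> (first_obs n x) * \<pi> (l n) \<theta> / M - p n \<theta> (first_obs n x) * \<pi> l0 \<theta> / m0\<bar> \<partial>\<nu>)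
        \<le> ennreal (2 * \<rho> + 2 * \<rho>)"
    proof (rule L1_distance_normalized_le[OF p_section_measurable[OF n] pi_measurable[OF ln] pi_measurable[OF l0']
          p_nonneg[OF n _ first_obs_in_space] pi_nonneg[OF ln] pi_nonneg[OF l0'] pi_integral[OF ln] _ _
          m(4,3)[unfolded marginal_def] m(1,2)])
      fix \<theta> assume \<theta>: "\<theta> \<in> space \<nu>"
      show "\<pi> (l n) \<theta> \<le> (1 + \<rho>) * \<pi> l0 \<theta> \<or> p n \<theta> (first_obs n x) \<le> \<rho> * m0"
      proof (cases "\<theta> \<in> d_ball (space \<nu>) d \<theta>0 \<epsilon>")
        case True
        have "ennreal (\<pi> (l n) \<theta>) \<le> ennreal ((1 + \<rho>) * \<pi> l0 \<theta>)"
          using prior_le_sup_prior[OF ln] \<epsilon>(2)[OF True] by (rule order_trans)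
        then show ?thesis using pi_nonneg[OF l0' \<theta>] \<rho> by (subst (asm) ennreal_le_iff) auto
      qed (use far \<theta> in auto)
    qed (use \<rho> in auto)
    also have "2 * \<rho> + 2 * \<rho> = e" by (simp add: \<rho>_def)
    finally show ?case using m by (simp add: posterior_density_def)
  qed
qed simp_all

end

section \<open>Assembly of the conclusions under the true law\<close>

theorem theorem3p1:
  fixes \<Theta> :: "(real ^ 'k) set"
    and \<Lambda> \<Lambda>c :: "(real ^ 'l) set"
    and P :: "real ^ 'k \<Rightarrow> (nat \<Rightarrow> 'x::polish_space) measure"
    and \<mu> :: "nat \<Rightarrow> (nat \<Rightarrow> 'x) measure"
    and p :: "nat \<Rightarrow> real ^ 'k \<Rightarrow> (nat \<Rightarrow> 'x) \<Rightarrow> real"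
    and \<nu> :: "(real ^ 'k) measure"
    and \<pi> :: "real ^ 'l \<Rightarrow> real ^ 'k \<Rightarrow> real"
    and d :: "real ^ 'k \<Rightarrow> real ^ 'k \<Rightarrow> real"
    and dL :: "real ^ 'l \<Rightarrow> real ^ 'l \<Rightarrow> real"
    and lhat :: "nat \<Rightarrow> (nat \<Rightarrow> 'x) \<Rightarrow> real ^ 'l"
    and \<theta>0 :: "real ^ 'k"
  defines "\<Lambda>0 \<equiv> Lambda0 \<Lambda> \<pi> \<theta>0"
    and "\<Lambda>0t \<equiv> Lambda0_tilde \<Theta> \<Lambda> \<nu> \<pi> d (P \<theta>0) p \<theta>0"
    and "g \<equiv> sup_prior \<Lambda> \<pi>"
  \<comment> \<open>parameter space and model\<close>
  assumes Theta: "completely_metrizable_space (top_of_set \<Theta>)" and theta0: "\<theta>0 \<in> \<Theta>"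
    and P_prob: "\<And>\<theta>. \<theta> \<in> \<Theta> \<Longrightarrow> prob_space (P \<theta>)"
    and P_sets: "\<And>\<theta>. \<theta> \<in> \<Theta> \<Longrightarrow> sets (P \<theta>) = sets (PiM UNIV (\<lambda>_. borel))"
    and mu: "\<And>n. n \<ge> 1 \<Longrightarrow> sigma_finite_measure (\<mu> n)"
    and mu_sets: "\<And>n. n \<ge> 1 \<Longrightarrow> sets (\<mu> n) = sets (PiM {..<n} (\<lambda>_. borel))"
    and p_nonneg: "\<And>n \<theta> y. n \<ge> 1 \<Longrightarrow> \<theta> \<in> \<Theta> \<Longrightarrow> y \<in> space (PiM {..<n} (\<lambda>_. borel)) \<Longrightarrow> 0 \<le> p n \<theta> y"
    and p_measurable: "\<And>n. n \<ge> 1 \<Longrightarrow>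
          (\<lambda>(x, \<theta>). p n \<theta> x) \<in> borel_measurable (PiM {..<n} (\<lambda>_. borel) \<Otimes>\<^sub>M restrict_space borel \<Theta>)"
    and p_density: "\<And>n \<theta>. n \<ge> 1 \<Longrightarrow> \<theta> \<in> \<Theta> \<Longrightarrow>
          distr (P \<theta>) (PiM {..<n} (\<lambda>_. borel)) (first_obs n) = density (\<mu> n) (\<lambda>x. ennreal (p n \<theta> x))"
    and KL_ex: "\<And>\<theta>. \<theta> \<in> \<Theta> \<Longrightarrow> \<exists>c. is_KL_inf (P \<theta>0) p \<theta>0 \<theta> c"
  \<comment> \<open>semi-metric on the parameter space\<close>
    and d: "semi_metric_on \<Theta> d"
    and d_ball_measurable: "\<And>\<epsilon>. \<epsilon> > 0 \<Longrightarrow> d_ball \<Theta> d \<theta>0 \<epsilon> \<in> sets (restrict_space borel \<Theta>)"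
    and KL_ball_measurable: "\<And>\<eta>. \<eta> > 0 \<Longrightarrow> KL_ball \<Theta> (P \<theta>0) p \<theta>0 \<eta> \<in> sets (restrict_space borel \<Theta>)"
  \<comment> \<open>priors\<close>
    and nu_sets: "sets \<nu> = sets (restrict_space borel \<Theta>)"
    and pi_nonneg: "\<And>l \<theta>. l \<in> \<Lambda> \<Longrightarrow> \<theta> \<in> \<Theta> \<Longrightarrow> 0 \<le> \<pi> l \<theta>"
    and pi_measurable: "\<And>l. l \<in> \<Lambda> \<Longrightarrow> \<pi> l \<in> borel_measurable \<nu>"
    and pi_prob: "\<And>l. l \<in> \<Lambda> \<Longrightarrow> prob_space (prior \<nu> \<pi> l)"
    and g_measurable: "g \<in> borel_measurable (restrict_space borel \<Theta>)"
    and g_finite: "g \<theta>0 < \<infinity>"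
  \<comment> \<open>the estimator takes its values in a set between the hyperparameter set and its closure,
      to which the metric is extended continuously\<close>
    and Lc: "\<Lambda> \<subseteq> \<Lambda>c" "\<Lambda>c \<subseteq> closure \<Lambda>"
    and dL: "Metric_space \<Lambda>c dL"
    and dL_boundary: "\<And>l. l \<in> \<Lambda>c - \<Lambda> \<Longrightarrow> ((\<lambda>l'. dL l' l) \<longlongrightarrow> 0) (at l within \<Lambda>)"
    and lhat_range: "\<And>n y. lhat n y \<in> \<Lambda>c"
    and lhat_mmle: "\<And>\<theta>. \<theta> \<in> \<Theta> \<Longrightarrow> AE x in P \<theta>. \<forall>\<^sub>F n in sequentially.
          is_maximizer \<Lambda> (marginal \<nu> p \<pi> n x) (lhat n (first_obs n x))"
    and mhat_finite: "\<And>\<theta>. \<theta> \<in> \<Theta> \<Longrightarrow> AE x in P \<theta>. \<forall>\<^sub>F n in sequentially.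
          max_marginal \<nu> p \<pi> \<Lambda> n x < \<infinity>"
    and eb_well_defined: "\<And>\<theta>. \<theta> \<in> \<Theta> \<Longrightarrow> AE x in P \<theta>. \<forall>\<^sub>F n in sequentially.
          posterior_well_defined \<Theta> \<Lambda> \<nu> \<pi> p n x (lhat n (first_obs n x))"
  \<comment> \<open>assumptions of the theorem\<close>
    and A1: "condition_A1 \<Theta> d (P \<theta>0) p \<theta>0"
    and i: "g \<theta>0 > 0" "d_continuous_at \<Theta> d \<theta>0 g"
    and ii: "\<Lambda>0t \<noteq> {}"
  shows "(\<forall>l0\<in>\<Lambda>0t. AE x in P \<theta>0.
            (\<lambda>n. max_marginal \<nu> p \<pi> \<Lambda> n x / marginal \<nu> p \<pi> n x l0) \<longlonglongrightarrow> 1) \<and>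
         (condition_iii \<Theta> \<Lambda> \<nu> \<pi> d dL (P \<theta>0) p \<theta>0 \<longrightarrow>
            (\<forall>l0\<in>\<Lambda>0. AE x in P \<theta>0. (\<lambda>n. d_set dL (lhat n (first_obs n x)) \<Lambda>0) \<longlonglongrightarrow> 0) \<and>
            \<comment> \<open>points of \<open>\<Lambda>c\<close> near \<open>\<Lambda>0\<close> must belong to \<open>\<Lambda>\<close>, or else the estimator may stay at boundary points
                where the prior has no density; automatic if \<open>\<Lambda>c = \<Lambda>\<close>\<close>
            ((\<exists>r>0. \<forall>l\<in>\<Lambda>c. d_set dL l \<Lambda>0 < r \<longrightarrow> l \<in> \<Lambda>) \<longrightarrow>
             (\<forall>l0\<in>\<Lambda>0. AE x in P \<theta>0.
                (\<forall>\<^sub>F n in sequentially. lhat n (first_obs n x) \<in> \<Lambda> \<and>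
                   prob_space (density \<nu>
                     (\<lambda>\<theta>. ennreal (posterior_density \<nu> p \<pi> n x (lhat n (first_obs n x)) \<theta>)))) \<and>
                (\<lambda>n. \<integral>\<^sup>+\<theta>. ennreal \<bar>posterior_density \<nu> p \<pi> n x (lhat n (first_obs n x)) \<theta>
                                    - posterior_density \<nu> p \<pi> n x l0 \<theta>\<bar> \<partial>\<nu>) \<longlonglongrightarrow> 0)))"
proof -
  have space_nu: "space \<nu> = \<Theta>"
    using sets_eq_imp_space_eq[OF nu_sets] by (simp add: space_restrict_space)
  note fin = mhat_finite[OF theta0] and lhat_max = lhat_mmle[OF theta0]
  interpret bayes_model "P \<theta>0" p \<theta>0 \<nu> \<pi> \<Lambda> d
  proof (rule bayes_model.intro[OF P_prob[OF theta0]], rule bayes_model_axioms.intro, unfold space_nu)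
    show "sets (P \<theta>0) = sets (PiM UNIV (\<lambda>_. borel))" by (rule P_sets[OF theta0])
    show p_meas: "(\<lambda>(x, \<theta>). p n \<theta> x) \<in> borel_measurable (PiM {..<n} (\<lambda>_. borel) \<Otimes>\<^sub>M \<nu>)" if "n \<ge> 1" for n
      using p_measurable[OF that] nu_sets by (simp cong: measurable_cong_sets sets_pair_measure_cong)
    \<comment> \<open>One null set for each sample size, hence countably many in all.\<close>
    show "AE x in P \<theta>0. \<forall>n\<ge>1. 0 < p n \<theta>0 (first_obs n x)"
      unfolding AE_all_countable
    proof (intro allI)
      fix n
      show "AE x in P \<theta>0. 1 \<le> n \<longrightarrow> 0 < p n \<theta>0 (first_obs n x)"
      proof (cases "1 \<le> n")
        case True
        have "(\<lambda>x. (x, \<theta>0)) \<in> measurable (PiM {..<n} (\<lambda>_. borel)) (PiM {..<n} (\<lambda>_. borel) \<Otimes>\<^sub>M \<nu>)"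
          using theta0 space_nu by (intro measurable_Pair measurable_const measurable_ident_sets refl) simp
        from measurable_compose[OF this p_meas[OF True]]
        have "p n \<theta>0 \<in> borel_measurable (PiM {..<n} (\<lambda>_. borel))" by simp
        from AE_first_obs_density_pos[OF P_sets[OF theta0] mu_sets[OF True] this p_density[OF True theta0]]
        show ?thesis by eventually_elim simp
      qed simp
    qed
    show "KL_ball \<Theta> (P \<theta>0) p \<theta>0 \<eta> \<in> sets \<nu>" if "\<eta> > 0" for \<eta>
      unfolding nu_sets using that by (rule KL_ball_measurable)
  qed (fact theta0 p_nonneg KL_ex pi_nonneg pi_measurable pi_prob A1)+
  have g: "sup_prior \<Lambda> \<pi> \<theta>0 > 0" "d_continuous_at (space \<nu>) d \<theta>0 (sup_prior \<Lambda> \<pi>)"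
    using i by (simp_all add: g_def space_nu)
  have tilde: "l0 \<in> Lambda0 \<Lambda> \<pi> \<theta>0" "l0 \<in> \<Lambda>" "d_continuous_at (space \<nu>) d \<theta>0 (\<pi> l0)"
    "AE x in P \<theta>0. far_negligible l0 x" if "l0 \<in> \<Lambda>0t" for l0
  proof -
    from that show l0: "l0 \<in> Lambda0 \<Lambda> \<pi> \<theta>0" "d_continuous_at (space \<nu>) d \<theta>0 (\<pi> l0)"
      by (simp_all add: \<Lambda>0t_def Lambda0_tilde_def space_nu)
    then show l: "l0 \<in> \<Lambda>" by (simp add: Lambda0_def)
    show "AE x in P \<theta>0. far_negligible l0 x"
    proof (rule AE_far_negligible[OF l])
      fix \<eta> :: real assume \<eta>: "\<eta> > 0"
      let ?K = "KL_ball (space \<nu>) (P \<theta>0) p \<theta>0 \<eta>"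
      \<comment> \<open>The radius 1 is an arbitrary choice; monotonicity passes the positive mass
        on to the whole Kullback-Leibler ball.\<close>
      have "0 < emeasure (prior \<nu> \<pi> l0) (d_ball \<Theta> d \<theta>0 1 \<inter> KL_ball \<Theta> (P \<theta>0) p \<theta>0 \<eta>)"
        using that \<eta> by (simp add: \<Lambda>0t_def Lambda0_tilde_def)
      also have "\<dots> \<le> emeasure (prior \<nu> \<pi> l0) ?K"
        using KL_ball_measurable[OF \<eta>] nu_sets by (intro emeasure_mono) (auto simp: space_nu sets_prior)
      finally show "0 < emeasure (prior \<nu> \<pi> l0) ?K" .
    qed
  qed
  have ratio: "AE x in P \<theta>0. (\<lambda>n. max_marginal \<nu> p \<pi> \<Lambda> n x / marginal \<nu> p \<pi> n x l0) \<longlonglongrightarrow> 1"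
    if l0: "l0 \<in> \<Lambda>0t" for l0
    using tilde(4)[OF l0] fin
    by eventually_elim (rule max_marginal_ratio_tendsto[OF tilde(1,3)[OF l0] g])
  moreover have
    "(\<forall>l0\<in>\<Lambda>0. AE x in P \<theta>0. (\<lambda>n. d_set dL (lhat n (first_obs n x)) \<Lambda>0) \<longlonglongrightarrow> 0) \<and>
     ((\<exists>r>0. \<forall>l\<in>\<Lambda>c. d_set dL l \<Lambda>0 < r \<longrightarrow> l \<in> \<Lambda>) \<longrightarrow>
       (\<forall>l0\<in>\<Lambda>0. AE x in P \<theta>0.
          (\<forall>\<^sub>F n in sequentially. lhat n (first_obs n x) \<in> \<Lambda> \<and>
             prob_space (density \<nu>
               (\<lambda>\<theta>. ennreal (posterior_density \<nu> p \<pi> n x (lhat n (first_obs n x)) \<theta>)))) \<and>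
          (\<lambda>n. \<integral>\<^sup>+\<theta>. ennreal \<bar>posterior_density \<nu> p \<pi> n x (lhat n (first_obs n x)) \<theta>
                              - posterior_density \<nu> p \<pi> n x l0 \<theta>\<bar> \<partial>\<nu>) \<longlonglongrightarrow> 0))"
    if iii: "condition_iii \<Theta> \<Lambda> \<nu> \<pi> d dL (P \<theta>0) p \<theta>0"
  proof -
    have eq: "\<Lambda>0t = \<Lambda>0" using iii by (simp add: condition_iii_def \<Lambda>0_def \<Lambda>0t_def)
    have \<Lambda>0: "\<Lambda>0 \<noteq> {}" "\<Lambda>0 \<subseteq> \<Lambda>c" using ii eq Lc(1) tilde(2) by auto
    have consistent: "(\<lambda>n. d_set dL (lhat n (first_obs n x)) \<Lambda>0) \<longlonglongrightarrow> 0"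
      if l0: "l0 \<in> \<Lambda>0" and far: "far_negligible l0 x"
        and fin: "\<forall>\<^sub>F n in sequentially. max_marginal \<nu> p \<pi> \<Lambda> n x < \<infinity>"
        and max: "\<forall>\<^sub>F n in sequentially. is_maximizer \<Lambda> (marginal \<nu> p \<pi> n x) (lhat n (first_obs n x))"
      for l0 x
    proof (rule order_tendstoI)
      fix a :: real assume "a < 0"
      with d_set_nonneg[OF dL \<Lambda>0(1)]
      show "\<forall>\<^sub>F n in sequentially. a < d_set dL (lhat n (first_obs n x)) \<Lambda>0"
        by (intro always_eventually allI) (rule less_le_trans)
    next
      fix a :: real assume a: "0 < a"
      note l0' = l0[folded eq]
      \<comment> \<open>Three nested radii: separation is applied beyond \<open>a / 3\<close>, a
        boundary maximizer is then within \<open>a / 2\<close>, and the limit needs strictly less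
        than \<open>a\<close>.\<close>
      define L where "L = {l\<in>\<Lambda>. d_set dL l \<Lambda>0 > a / 3}"
      have "a / 3 > 0" using a by simp
      with iii obtain \<epsilon> \<eta> where "\<epsilon> > 0" "\<eta> > 0" and
        "(SUP \<theta>\<in>d_ball (space \<nu>) d \<theta>0 \<epsilon>. SUP l\<in>L. ennreal (\<pi> l \<theta>) / sup_prior \<Lambda> \<pi> \<theta>) \<le> ennreal (1 - \<eta>)"
        unfolding condition_iii_def L_def space_nu \<Lambda>0_def by blast
      then obtain s where s: "s < 1" "\<forall>\<^sub>F n in sequentially. \<forall>l\<in>L. marginal \<nu> p \<pi> n x l \<le> ennreal s * marginal \<nu> p \<pi> n x l0"
        using marginal_away_from_Lambda0[OF tilde(1,3)[OF l0'] g far fin, of L] by (auto simp: L_def)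
      from s(2) max far_negligible_real[OF far zero_less_one zero_less_one tilde(2)[OF l0'] fin]
      show "\<forall>\<^sub>F n in sequentially. d_set dL (lhat n (first_obs n x)) \<Lambda>0 < a"
      proof eventually_elim
        case (elim n)
        then obtain m0 M where m: "0 < m0" "m0 \<le> M" "marginal \<nu> p \<pi> n x l0 = ennreal m0"
          "max_marginal \<nu> p \<pi> \<Lambda> n x = ennreal M" by blast
        have "d_set dL (lhat n (first_obs n x)) \<Lambda>0 \<le> a / 2"
        proof (rule is_maximizer_d_set_le[OF dL \<Lambda>0 Lc(1) lhat_range _ elim(2)])
          show "ennreal s * marginal \<nu> p \<pi> n x l0 < (SUP l'\<in>\<Lambda>. marginal \<nu> p \<pi> n x l')"
          proof -
            \<comment> \<open>Far hyperparameters reach at most \<open>s * m0\<close>, strictly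
              below \<open>m0\<close> and hence below the supremum \<open>M\<close>.\<close>
            have "s * m0 < 1 * m0" using s(1) m(1) by (rule mult_strict_right_mono)
            then have "s * m0 < M" using m(2) by simp
            then have "ennreal (s * m0) < ennreal M" using m by (intro ennreal_lessI) auto
            then show ?thesis
              using m by (simp add: max_marginal_def ennreal_mult'')
          qed
          show "marginal \<nu> p \<pi> n x l' \<le> ennreal s * marginal \<nu> p \<pi> n x l0"
            if "l' \<in> \<Lambda>" "a / 3 < d_set dL l' \<Lambda>0" for l'
            using that elim(1) by (simp add: L_def)
          show "((\<lambda>l'. dL l' (lhat n (first_obs n x))) \<longlongrightarrow> 0) (at (lhat n (first_obs n x)) within \<Lambda>)"
            if "lhat n (first_obs n x) \<notin> \<Lambda>"
            using that lhat_range by (intro dL_boundary) auto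
        qed (use a in auto)
        then show ?case using a by linarith
      qed
    qed
    have merging: "(\<forall>\<^sub>F n in sequentially. lhat n (first_obs n x) \<in> \<Lambda> \<and>
           prob_space (density \<nu>
             (\<lambda>\<theta>. ennreal (posterior_density \<nu> p \<pi> n x (lhat n (first_obs n x)) \<theta>)))) \<and>
        (\<lambda>n. \<integral>\<^sup>+\<theta>. ennreal \<bar>posterior_density \<nu> p \<pi> n x (lhat n (first_obs n x)) \<theta>
                            - posterior_density \<nu> p \<pi> n x l0 \<theta>\<bar> \<partial>\<nu>) \<longlonglongrightarrow> 0"
      if r: "r > 0" "\<forall>l\<in>\<Lambda>c. d_set dL l \<Lambda>0 < r \<longrightarrow> l \<in> \<Lambda>"
        and l0: "l0 \<in> \<Lambda>0" and far: "far_negligible l0 x"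
        and fin: "\<forall>\<^sub>F n in sequentially. max_marginal \<nu> p \<pi> \<Lambda> n x < \<infinity>"
        and max: "\<forall>\<^sub>F n in sequentially. is_maximizer \<Lambda> (marginal \<nu> p \<pi> n x) (lhat n (first_obs n x))"
      for r l0 x
    proof
      note l0' = l0[folded eq]
      have "\<forall>\<^sub>F n in sequentially. d_set dL (lhat n (first_obs n x)) \<Lambda>0 < r"
        using consistent[OF l0 far fin max] r(1) by (rule order_tendstoD(2))
      \<comment> \<open>Within distance \<open>r\<close> of \<open>\<Lambda>0\<close> the estimator
        belongs to \<open>\<Lambda>\<close>, where being a maximizer means that the supremum is
        attained.\<close>
      with max have lhat: "\<forall>\<^sub>F n in sequentially. lhat n (first_obs n x) \<in> \<Lambda> \<and>
          marginal \<nu> p \<pi> n x (lhat n (first_obs n x)) = max_marginal \<nu> p \<pi> \<Lambda> n x"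
        by eventually_elim (use r(2) lhat_range in \<open>simp add: is_maximizer_def max_marginal_def\<close>)
      then show "(\<lambda>n. \<integral>\<^sup>+\<theta>. ennreal \<bar>posterior_density \<nu> p \<pi> n x (lhat n (first_obs n x)) \<theta>
                            - posterior_density \<nu> p \<pi> n x l0 \<theta>\<bar> \<partial>\<nu>) \<longlonglongrightarrow> 0"
        by (rule posterior_density_L1_tendsto[OF tilde(1,3)[OF l0'] g far fin])
      from lhat far_negligible_real[OF far zero_less_one zero_less_one tilde(2)[OF l0'] fin]
      show "\<forall>\<^sub>F n in sequentially. lhat n (first_obs n x) \<in> \<Lambda> \<and>
          prob_space (density \<nu>
            (\<lambda>\<theta>. ennreal (posterior_density \<nu> p \<pi> n x (lhat n (first_obs n x)) \<theta>)))"
        by eventually_elim (auto intro!: posterior_density_prob_space)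
    qed
    show ?thesis
    proof (intro conjI ballI impI; (elim exE conjE)?)
      fix l0 assume l0: "l0 \<in> \<Lambda>0"
      show "AE x in P \<theta>0. (\<lambda>n. d_set dL (lhat n (first_obs n x)) \<Lambda>0) \<longlonglongrightarrow> 0"
        using tilde(4)[OF l0[folded eq]] fin lhat_max
        by eventually_elim (rule consistent[OF l0])
    next
      fix l0 r assume l0: "l0 \<in> \<Lambda>0" and r: "0 < r" "\<forall>l\<in>\<Lambda>c. d_set dL l \<Lambda>0 < r \<longrightarrow> l \<in> \<Lambda>"
      show "AE x in P \<theta>0.
          (\<forall>\<^sub>F n in sequentially. lhat n (first_obs n x) \<in> \<Lambda> \<and>
             prob_space (density \<nu>
               (\<lambda>\<theta>. ennreal (posterior_density \<nu> p \<pi> n x (lhat n (first_obs n x)) \<theta>)))) \<and>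
          (\<lambda>n. \<integral>\<^sup>+\<theta>. ennreal \<bar>posterior_density \<nu> p \<pi> n x (lhat n (first_obs n x)) \<theta>
                              - posterior_density \<nu> p \<pi> n x l0 \<theta>\<bar> \<partial>\<nu>) \<longlonglongrightarrow> 0"
        using tilde(4)[OF l0[folded eq]] fin lhat_max
        by eventually_elim (rule merging[OF r l0])
    qed
  qed
  ultimately show ?thesis by blast
qed

end
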